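(* Let $n\geq 2$ and $1\leq q\leq n-1$. Let $D$ be a bounded domain in $\mathbb{C}^n$ with smooth boundary. Let $\{D_j\}_{j\geq 1}$ be a sequence of open subsets of $D$ with $D_j\subset D_{j+1}$ for all $j$ and $\bigcup_j D_j=D$. If each $D_j$ is hyper-$q$-convex, then $D$ is hyper-$q$-convex.
   Context: Hyper-$q$-convexity. Let $\Omega\subset\mathbb{C}^n$ be a bounded open set with smooth boundary, and let $\rho:\mathbb{C}^n\to\mathbb{R}$ be a smooth defining function: $\Omega=\{z:\rho(z)<0\}$, $\nabla\rho\neq 0$ on $\partial\Omega$, normalized so that $|\nabla\rho|=1$ on $\partial\Omega$. For $p\in\partial\Omega$, the complex tangent space is $T^{1,0}_p\partial\Omega=\{\xi\in\mathbb{C}^n:\sum_{i}\frac{\partial\rho}{\partial z_i}(p)\xi_i=0\}$ (complex dimension $n-1$), with the Hermitian inner product induced from $\mathbb{C}^n$. The Levi form at $p$ is the restriction to $T^{1,0}_p\partial\Omega$ of the Hermitian form $\xi\mapsto\sum_{i,j}\frac{\partial^2\rho}{\partial z_i\partial\bar z_j}(p)\xi_i\bar\xi_j$. For $1\leq q\leq n-1$, $\Omega$ is called hyper-$q$-convex if at every $p\in\partial\Omega$ the sum of any $q$ eigenvalues (counted with multiplicity) of the Levi form on $T^{1,0}_p\partial\Omega$ is non-negative. In particular, saying that an open set is hyper-$q$-convex presupposes that it is bounded with smooth boundary. *)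

theory Defs
  imports "HOL-Analysis.Analysis" "HOL-Library.Multiset"
begin

text \<open>For a finite-dimensional domain, this is \<open>k\<close>-fold continuous real differentiability:
  all iterated directional derivatives of order at most \<open>k\<close> exist and are continuous.\<close>

primrec times_continuously_differentiable ::
    "nat \<Rightarrow> ('a::euclidean_space \<Rightarrow> 'b::real_normed_vector) \<Rightarrow> bool" where
  "times_continuously_differentiable 0 f \<longleftrightarrow> continuous_on UNIV f"
| "times_continuously_differentiable (Suc k) f \<longleftrightarrow>
     (\<forall>x. f differentiable (at x)) \<and>
     (\<forall>v. times_continuously_differentiable k (\<lambda>x. frechet_derivative f (at x) v))"

definition smooth :: "('a::euclidean_space \<Rightarrow> 'b::real_normed_vector) \<Rightarrow> bool" where
  "smooth f \<longleftrightarrow> (\<forall>k. times_continuously_differentiable k f)"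

definition defining_function :: "(complex^'n) set \<Rightarrow> (complex^'n \<Rightarrow> real) \<Rightarrow> bool" where
  "defining_function \<Omega> \<rho> \<longleftrightarrow>
     smooth \<rho> \<and> \<Omega> = {z. \<rho> z < 0} \<and>
     (\<forall>p\<in>frontier \<Omega>. \<exists>g. GDERIV \<rho> p :> g \<and> g \<noteq> 0)"

definition normalized_defining_function :: "(complex^'n) set \<Rightarrow> (complex^'n \<Rightarrow> real) \<Rightarrow> bool" where
  "normalized_defining_function \<Omega> \<rho> \<longleftrightarrow>
     defining_function \<Omega> \<rho> \<and>
     (\<forall>p\<in>frontier \<Omega>. \<exists>g. GDERIV \<rho> p :> g \<and> norm g = 1)"

definition has_smooth_boundary :: "(complex^'n) set \<Rightarrow> bool" where
  "has_smooth_boundary \<Omega> \<longleftrightarrow> (\<exists>\<rho>. defining_function \<Omega> \<rho>)"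

text \<open>The Wirtinger derivatives \<open>\<partial>/\<partial>z\<^sub>i = (\<partial>/\<partial>x\<^sub>i - \<i> \<partial>/\<partial>y\<^sub>i)/2\<close> and
  \<open>\<partial>/\<partial>z\<^sub>i\<close>-bar \<open>= (\<partial>/\<partial>x\<^sub>i + \<i> \<partial>/\<partial>y\<^sub>i)/2\<close>. The directions of \<open>x\<^sub>i\<close> and \<open>y\<^sub>i\<close> are
  \<open>axis i 1\<close> and \<open>axis i \<i>\<close>, and the Frechet derivative is the real one.\<close>

definition wirtinger :: "'n \<Rightarrow> (complex^'n \<Rightarrow> complex) \<Rightarrow> complex^'n \<Rightarrow> complex" where
  "wirtinger i f p =
     (frechet_derivative f (at p) (axis i 1) - \<i> * frechet_derivative f (at p) (axis i \<i>)) / 2"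

definition wirtinger_bar :: "'n \<Rightarrow> (complex^'n \<Rightarrow> complex) \<Rightarrow> complex^'n \<Rightarrow> complex" where
  "wirtinger_bar i f p =
     (frechet_derivative f (at p) (axis i 1) + \<i> * frechet_derivative f (at p) (axis i \<i>)) / 2"

definition hermitian_inner :: "complex^'n \<Rightarrow> complex^'n \<Rightarrow> complex" where
  "hermitian_inner \<xi> \<eta> = (\<Sum>i\<in>UNIV. \<xi> $ i * cnj (\<eta> $ i))"

definition complex_tangent_space :: "(complex^'n \<Rightarrow> real) \<Rightarrow> complex^'n \<Rightarrow> (complex^'n) set" where
  "complex_tangent_space \<rho> p =
     {\<xi>. (\<Sum>i\<in>UNIV. wirtinger i (\<lambda>z. complex_of_real (\<rho> z)) p * \<xi> $ i) = 0}"

definition levi_form :: "(complex^'n \<Rightarrow> real) \<Rightarrow> complex^'n \<Rightarrow> complex^'n \<Rightarrow> complex^'n \<Rightarrow> complex" where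
  "levi_form \<rho> p \<xi> \<eta> =
     (\<Sum>i\<in>UNIV. \<Sum>j\<in>UNIV.
        wirtinger i (wirtinger_bar j (\<lambda>z. complex_of_real (\<rho> z))) p * \<xi> $ i * cnj (\<eta> $ j))"

text \<open>Eigenvectors of the Levi form as a Hermitian form on the complex tangent space, relative to
  the induced inner product; eigenvalues of a Hermitian form are real.\<close>

definition levi_eigenspace :: "(complex^'n \<Rightarrow> real) \<Rightarrow> complex^'n \<Rightarrow> real \<Rightarrow> (complex^'n) set" where
  "levi_eigenspace \<rho> p \<mu> =
     {\<xi> \<in> complex_tangent_space \<rho> p.
        \<forall>\<eta>\<in>complex_tangent_space \<rho> p.
          levi_form \<rho> p \<xi> \<eta> = complex_of_real \<mu> * hermitian_inner \<xi> \<eta>}"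

text \<open>\<open>vec.dim\<close> is the dimension over the complex numbers, so it gives the multiplicity of an
  eigenvalue (and 0 if \<open>\<mu>\<close> is not an eigenvalue). A choice of \<open>q\<close> eigenvalues counted with
  multiplicity is a multiset \<open>M\<close> of size \<open>q\<close> in which no number occurs more often than its
  multiplicity.\<close>

definition hyper_q_convex :: "nat \<Rightarrow> (complex^'n) set \<Rightarrow> bool" where
  "hyper_q_convex q \<Omega> \<longleftrightarrow>
     bounded \<Omega> \<and> open \<Omega> \<and> has_smooth_boundary \<Omega> \<and>
     (\<exists>\<rho>. normalized_defining_function \<Omega> \<rho> \<and>
        (\<forall>p\<in>frontier \<Omega>. \<forall>M :: real multiset.
           size M = q \<and> (\<forall>\<mu>. count M \<mu> \<le> vec.dim (levi_eigenspace \<rho> p \<mu>))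
             \<longrightarrow> 0 \<le> sum_mset M))"

end

theory Submission
  imports Defs
begin

text \<open>Let \<open>\<rho>\<close> be a normalized defining function of \<open>D\<close> and \<open>p\<close> a boundary point. On \<open>C\<^sub>j\<close>, the part of
  the closed unit ball around \<open>p\<close> outside \<open>D\<^sub>j\<close>, let \<open>z\<^sub>j\<close> minimize \<open>\<phi> = \<rho> + \<epsilon>|z - p|\<^sup>2\<close>. Since the \<open>D\<^sub>j\<close>
  exhaust \<open>D\<close>, \<open>z\<^sub>j\<close> tends to \<open>p\<close>, and \<open>z\<^sub>j\<close> lies on the boundary of \<open>D\<^sub>j\<close>, where a sublevel set of \<open>\<phi>\<close>
  touches \<open>D\<^sub>j\<close> from inside. The second-order Lagrange condition bounds a non-negative multiple of the
  Levi form of \<open>D\<^sub>j\<close> by that of \<open>\<phi>\<close> on the complex tangent space at \<open>z\<^sub>j\<close>. By Ky Fan's minimum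
  principle, hyper-\<open>q\<close>-convexity says that the Levi form has non-negative trace over every \<open>q\<close>
  orthonormal tangent vectors, so this passes from \<open>D\<^sub>j\<close> to \<open>\<phi>\<close>. Letting \<open>j\<close> tend to infinity and then
  \<open>\<epsilon>\<close> to zero gives the claim for \<open>\<rho>\<close>.\<close>

section \<open>Smooth functions\<close>

lemma tcd_differentiable:
  "times_continuously_differentiable (Suc k) f \<Longrightarrow> f differentiable (at x)"
  by simp

lemma tcd_derivative:
  "times_continuously_differentiable (Suc k) f \<Longrightarrow>
    times_continuously_differentiable k (\<lambda>x. frechet_derivative f (at x) v)"
  by simp

lemma tcd_continuous:
  "times_continuously_differentiable k f \<Longrightarrow> continuous_on UNIV f"
  by (cases k) (auto intro!: continuous_at_imp_continuous_on differentiable_imp_continuous_within)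

text \<open>Derivatives are unique, so an explicit formula may stand in for
  \<open>frechet_derivative\<close>. The closure rules below use this to pass from order
  \<open>k\<close> to \<open>Suc k\<close>.\<close>

lemma tcd_SucI:
  assumes "\<And>x. (f has_derivative f' x) (at x)"
    and "\<And>v. times_continuously_differentiable k (\<lambda>x. f' x v)"
  shows "times_continuously_differentiable (Suc k) f"
proof -
  have "frechet_derivative f (at x) = f' x" for x
    using assms(1) by (metis frechet_derivative_at)
  then show ?thesis
    using assms by (auto simp: differentiable_def)
qed

lemma tcd_has_derivative:
  "times_continuously_differentiable (Suc k) f \<Longrightarrow>
    (f has_derivative frechet_derivative f (at x)) (at x)"
  using frechet_derivative_works tcd_differentiable by blast

lemma tcd_Suc_D:
  "times_continuously_differentiable (Suc k) f \<Longrightarrow> times_continuously_differentiable k f"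
proof (induction k arbitrary: f)
  case 0
  then show ?case by (metis tcd_continuous times_continuously_differentiable.simps(1))
next
  case (Suc k)
  show ?case
    by (rule tcd_SucI[OF tcd_has_derivative[OF Suc.prems]]) (intro Suc.IH tcd_derivative Suc.prems)
qed

lemma tcd_const: "times_continuously_differentiable k (\<lambda>x. c)"
  by (induction k arbitrary: c) (auto simp: continuous_on_const)

lemma tcd_bounded_linear:
  assumes "bounded_linear f"
  shows "times_continuously_differentiable k f"
proof (cases k)
  case 0
  then show ?thesis
    by (simp add: assms linear_continuous_on)
next
  case (Suc m)
  show ?thesis unfolding Suc
    by (rule tcd_SucI[of _ "\<lambda>x. f"]) (auto intro: tcd_const bounded_linear_imp_has_derivative assms)
qed

lemma tcd_add:
  assumes "times_continuously_differentiable k f" "times_continuously_differentiable k g"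
  shows "times_continuously_differentiable k (\<lambda>x. f x + g x)"
  using assms
proof (induction k arbitrary: f g)
  case 0
  then show ?case by (auto intro: continuous_intros)
next
  case (Suc k)
  show ?case
    by (rule tcd_SucI[OF has_derivative_add[OF tcd_has_derivative[OF Suc.prems(1)]
            tcd_has_derivative[OF Suc.prems(2)]]])
       (intro Suc.IH tcd_derivative Suc.prems)
qed

lemma tcd_mult:
  fixes f g :: "'a::euclidean_space \<Rightarrow> real"
  assumes "times_continuously_differentiable k f" "times_continuously_differentiable k g"
  shows "times_continuously_differentiable k (\<lambda>x. f x * g x)"
  using assms
proof (induction k arbitrary: f g)
  case 0
  then show ?case by (auto intro: continuous_intros)
next
  case (Suc k)
  show ?case
    by (rule tcd_SucI[OF has_derivative_mult[OF tcd_has_derivative[OF Suc.prems(1)]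
            tcd_has_derivative[OF Suc.prems(2)]]])
       (intro Suc.IH tcd_add tcd_derivative Suc.prems tcd_Suc_D[OF Suc.prems(1)]
          tcd_Suc_D[OF Suc.prems(2)])
qed

text \<open>Differentiability of \<open>a\<close> is asked only at values of \<open>f\<close>, since
  \<open>powr\<close> may fail to be differentiable at 0. Asking for order \<open>k\<close> of
  \<open>a'\<close> composed with \<open>f\<close>, and not of \<open>a'\<close> itself, fits the
  inductions for \<open>powr\<close> and \<open>flat\<close>.\<close>

lemma tcd_chain:
  fixes a a' :: "real \<Rightarrow> real" and f :: "'a::euclidean_space \<Rightarrow> real"
  assumes f: "times_continuously_differentiable (Suc k) f"
    and a: "\<And>x. (a has_real_derivative a' (f x)) (at (f x))"
    and a': "times_continuously_differentiable k (\<lambda>x. a' (f x))"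
  shows "times_continuously_differentiable (Suc k) (\<lambda>x. a (f x))"
proof (rule tcd_SucI)
  show "((\<lambda>x. a (f x)) has_derivative (\<lambda>v. a' (f x) * frechet_derivative f (at x) v)) (at x)" for x
    using has_derivative_compose[OF tcd_has_derivative[OF f] a[unfolded has_field_derivative_def]]
    by simp
  show "times_continuously_differentiable k (\<lambda>x. a' (f x) * frechet_derivative f (at x) v)" for v
    by (intro tcd_mult a' tcd_derivative f)
qed

lemma tcd_powr:
  fixes f :: "'a::euclidean_space \<Rightarrow> real"
  assumes "times_continuously_differentiable k f" and pos: "\<And>x. f x > 0"
  shows "times_continuously_differentiable k (\<lambda>x. f x powr r)"
  using assms(1)
proof (induction k arbitrary: r)
  case 0
  have "f x \<noteq> 0" for x using pos[of x] by simp
  with 0 show ?case by (auto intro: continuous_on_powr continuous_on_const)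
next
  case (Suc k)
  show ?case
  proof (rule tcd_chain[OF Suc.prems])
    show "((\<lambda>t. t powr r) has_real_derivative r * f x powr (r - 1)) (at (f x))" for x
      by (rule has_real_derivative_powr) (rule pos)
    show "times_continuously_differentiable k (\<lambda>x. r * f x powr (r - 1))"
      by (intro tcd_mult tcd_const Suc.IH tcd_Suc_D[OF Suc.prems])
  qed
qed

text \<open>The classical function \<open>exp (- 1 / t)\<close>, extended by 0 to the left, and its
  multiples by powers of \<open>1 / t\<close>. With these powers the family is closed under
  differentiation up to linear combinations, so smoothness follows by induction on the order for all
  \<open>n\<close> at once.\<close>

definition flat :: "nat \<Rightarrow> real \<Rightarrow> real" where
  "flat n t = (if t > 0 then inverse t ^ n * exp (- inverse t) else 0)"

text \<open>From the right, \<open>s = inverse t\<close> turns this into the decay of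
  \<open>s ^ n / exp s\<close> at infinity.\<close>

lemma flat_at_0: "(flat n \<longlongrightarrow> 0) (at 0)"
proof -
  have "((\<lambda>t. inverse t ^ n / exp (inverse t)) \<longlongrightarrow> (0::real)) (at_right 0)"
    by (rule filterlim_compose[OF tendsto_power_div_exp_0 filterlim_inverse_at_top_right])
  then have "(flat n \<longlongrightarrow> 0) (at_right 0)"
    by (rule Lim_transform_eventually)
       (auto simp: eventually_at_filter flat_def exp_minus field_simps)
  moreover have "(flat n \<longlongrightarrow> 0) (at_left 0)"
    by (rule Lim_transform_eventually[OF tendsto_const])
       (auto simp: eventually_at_filter flat_def)
  ultimately show ?thesis by (simp add: filterlim_split_at)
qed

lemma flat_has_derivative:
  "(flat n has_real_derivative flat (n + 2) t - real n * flat (n + 1) t) (at t)"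
proof -
  consider "t > 0" | "t = 0" | "t < 0" by linarith
  then show ?thesis
  proof cases
    case 1
    have "((\<lambda>t. inverse t ^ n * exp (- inverse t)) has_real_derivative
        flat (n + 2) t - real n * flat (n + 1) t) (at t)"
    proof -
      have i: "(inverse has_real_derivative - (inverse t ^ Suc (Suc 0))) (at t)"
        using 1 by (intro DERIV_inverse) simp
      show ?thesis
        by (rule DERIV_cong[OF DERIV_mult[OF DERIV_power[OF i]
                DERIV_chain2[OF DERIV_exp DERIV_minus[OF i]]]])
           (use 1 in \<open>cases n; simp add: flat_def algebra_simps\<close>)
    qed
    then show ?thesis
      by (rule has_field_derivative_transform_within_open[of _ _ _ "{0<..}"])
         (use 1 in \<open>auto simp: flat_def\<close>)
  next
    case 2
    \<comment> \<open>For nonzero \<open>h\<close> the difference quotient of \<open>flat n\<close>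
      at 0 is \<open>flat (n + 1) h\<close>.\<close>
    have "((\<lambda>h. (flat n (0 + h) - flat n 0) / h) \<longlongrightarrow> 0) (at 0)"
      by (rule Lim_transform_eventually[OF flat_at_0[of "n + 1"]])
         (auto simp: eventually_at_filter flat_def divide_inverse)
    then show ?thesis
      unfolding DERIV_def using 2 by (simp add: flat_def)
  next
    case 3
    have "((\<lambda>t. 0) has_real_derivative 0) (at t)" by simp
    then have "(flat n has_real_derivative 0) (at t)"
      by (rule has_field_derivative_transform_within_open[of _ _ _ "{..<0}"])
         (use 3 in \<open>auto simp: flat_def\<close>)
    then show ?thesis using 3 by (simp add: flat_def)
  qed
qed

lemma tcd_flat:
  fixes f :: "'a::euclidean_space \<Rightarrow> real"
  assumes "times_continuously_differentiable k f"
  shows "times_continuously_differentiable k (\<lambda>x. flat n (f x))"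
  using assms
proof (induction k arbitrary: n)
  case 0
  have "continuous_on UNIV (flat n)"
    by (intro continuous_at_imp_continuous_on ballI DERIV_isCont[OF flat_has_derivative])
  with 0 show ?case
    using continuous_on_compose2[of UNIV "flat n" UNIV f] by simp
next
  case (Suc k)
  show ?case
  proof (rule tcd_chain[OF Suc.prems flat_has_derivative])
    have "times_continuously_differentiable k
       (\<lambda>x. flat (n + 2) (f x) + (- real n) * flat (n + 1) (f x))"
      by (intro tcd_add tcd_mult tcd_const Suc.IH tcd_Suc_D[OF Suc.prems])
    then show "times_continuously_differentiable k
       (\<lambda>x. flat (n + 2) (f x) - real n * flat (n + 1) (f x))"
      by simp
  qed
qed

section \<open>Smooth functions and the normalization of defining functions\<close>

lemma smooth_has_derivative:
  "smooth f \<Longrightarrow> (f has_derivative frechet_derivative f (at x)) (at x)"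
  using tcd_has_derivative unfolding smooth_def by blast

lemma smooth_derivative: "smooth f \<Longrightarrow> smooth (\<lambda>x. frechet_derivative f (at x) v)"
  using tcd_derivative unfolding smooth_def by blast

lemma smooth_continuous: "smooth f \<Longrightarrow> continuous_on UNIV f"
  using tcd_continuous unfolding smooth_def by blast

lemma smooth_const: "smooth (\<lambda>x. c)"
  by (simp add: smooth_def tcd_const)

lemma smooth_bounded_linear: "bounded_linear f \<Longrightarrow> smooth f"
  by (simp add: smooth_def tcd_bounded_linear)

lemma smooth_add: "smooth f \<Longrightarrow> smooth g \<Longrightarrow> smooth (\<lambda>x. f x + g x)"
  by (simp add: smooth_def tcd_add)

lemma smooth_mult:
  fixes f g :: "'a::euclidean_space \<Rightarrow> real"
  shows "smooth f \<Longrightarrow> smooth g \<Longrightarrow> smooth (\<lambda>x. f x * g x)"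
  by (simp add: smooth_def tcd_mult)

lemma smooth_sum: "(\<And>i. i \<in> I \<Longrightarrow> smooth (f i)) \<Longrightarrow> smooth (\<lambda>x. \<Sum>i\<in>I. f i x)"
  by (induction I rule: infinite_finite_induct) (auto intro: smooth_const smooth_add)

lemma smooth_powr:
  fixes f :: "'a::euclidean_space \<Rightarrow> real"
  shows "smooth f \<Longrightarrow> (\<And>x. f x > 0) \<Longrightarrow> smooth (\<lambda>x. f x powr r)"
  by (simp add: smooth_def tcd_powr)

lemma smooth_flat:
  fixes f :: "'a::euclidean_space \<Rightarrow> real"
  shows "smooth f \<Longrightarrow> smooth (\<lambda>x. flat n (f x))"
  by (simp add: smooth_def tcd_flat)

lemma smooth_dist_square:
  fixes p :: "'a::euclidean_space"
  shows "smooth (\<lambda>z. (z - p) \<bullet> (z - p))"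
proof -
  have "smooth (\<lambda>z. \<Sum>b\<in>Basis. (z \<bullet> b + - (p \<bullet> b)) * (z \<bullet> b + - (p \<bullet> b)))"
    by (intro smooth_sum smooth_mult smooth_add smooth_const smooth_bounded_linear
        bounded_linear_inner_left)
  then show ?thesis
    by (subst euclidean_inner) (simp add: inner_diff_left)
qed

lemma frontier_sublevel:
  fixes r :: "'a::euclidean_space \<Rightarrow> real"
  assumes r: "smooth r" and p: "p \<in> frontier {z. r z < 0}"
  shows "r p = 0"
proof (rule antisym)
  have "closure {z. r z < 0} \<subseteq> {z. r z \<le> 0}"
    using smooth_continuous[OF r]
    by (intro closure_minimal closed_Collect_le continuous_on_const) auto
  then show "r p \<le> 0" using p by (auto simp: frontier_def)
  have "open {z. r z < 0}" using smooth_continuous[OF r]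
    by (intro open_Collect_less continuous_on_const) auto
  then show "r p \<ge> 0" using p frontier_disjoint_eq by fastforce
qed

text \<open>A defining function has to be divided by the length of its gradient, which may vanish
  off the frontier. Compactness of the frontier bounds the squared length there below by some
  \<open>c > 0\<close>; a flat correction, active only where it is less than \<open>c\<close>, makes
  it positive everywhere and leaves the frontier untouched.\<close>

lemma normalized_defining_function_exists:
  fixes \<Omega> :: "(complex^'n) set"
  assumes "bounded \<Omega>" "has_smooth_boundary \<Omega>"
  obtains \<rho> where "normalized_defining_function \<Omega> \<rho>"
proof -
  obtain r where r: "smooth r" and \<Omega>: "\<Omega> = {z. r z < 0}"
    and grad: "\<And>p. p \<in> frontier \<Omega> \<Longrightarrow> \<exists>g. GDERIV r p :> g \<and> g \<noteq> 0"
    using assms(2) unfolding has_smooth_boundary_def defining_function_def by blast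
  define g where "g x = (\<Sum>b\<in>Basis. frechet_derivative r (at x) b * frechet_derivative r (at x) b)" for x
  have g_smooth: "smooth g"
    unfolding g_def by (intro smooth_sum smooth_mult smooth_derivative r)
  have g_grad: "g x = norm d ^ 2" if "GDERIV r x :> d" for x d
  proof -
    have "frechet_derivative r (at x) = (\<lambda>h. h \<bullet> d)"
      using that unfolding gderiv_def by (metis frechet_derivative_at)
    then show ?thesis
      unfolding g_def power2_norm_eq_inner by (simp add: euclidean_inner[of d d] inner_commute)
  qed
  obtain c where c: "c > 0" "\<And>p. p \<in> frontier \<Omega> \<Longrightarrow> c \<le> g p"
  proof (cases "frontier \<Omega> = {}")
    case False
    have "compact (frontier \<Omega>)"
      using assms(1) by (rule compact_frontier_bounded)
    moreover have "continuous_on (frontier \<Omega>) g"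
      using g_smooth smooth_continuous continuous_on_subset by blast
    ultimately obtain p where p: "p \<in> frontier \<Omega>" "\<And>x. x \<in> frontier \<Omega> \<Longrightarrow> g p \<le> g x"
      using continuous_attains_inf[OF _ False] by blast
    moreover have "g p > 0" using grad[OF p(1)] g_grad by auto
    ultimately show ?thesis using that by blast
  qed (use that[of 1] in auto)
  \<comment> \<open>\<open>G\<close> is positive everywhere and agrees with \<open>g\<close>, the squared norm of the gradient, on the frontier.\<close>
  define G where "G x = g x + flat 0 (c + - 1 * g x)" for x
  have G_smooth: "smooth G"
    unfolding G_def by (intro smooth_add smooth_flat smooth_mult smooth_const g_smooth)
  have G_pos: "G x > 0" for x
  proof -
    have "g x \<ge> 0" by (auto simp: g_def intro: sum_nonneg)
    then show ?thesis using c(1) by (auto simp: G_def flat_def add_nonneg_pos)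
  qed
  define h where "h x = G x powr (-1/2)" for x
  have h_smooth: "smooth h"
    unfolding h_def by (intro smooth_powr G_smooth G_pos)
  have h_pos: "h x > 0" for x using G_pos[of x] by (simp add: h_def)
  have unit: "\<exists>d. GDERIV (\<lambda>x. h x * r x) p :> d \<and> norm d = 1" if p: "p \<in> frontier \<Omega>" for p
  proof -
    obtain d where d: "GDERIV r p :> d" "d \<noteq> 0" using grad p by blast
    have "r p = 0" using frontier_sublevel[OF r] p \<Omega> by blast
    moreover have "(h has_derivative frechet_derivative h (at p)) (at p)"
      using smooth_has_derivative h_smooth by blast
    \<comment> \<open>In the product rule the derivative of \<open>h\<close> carries the factor
      \<open>r p = 0\<close>, so the gradient is merely rescaled by \<open>h p\<close>.\<close>
    ultimately have "GDERIV (\<lambda>x. h x * r x) p :> h p *\<^sub>R d"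
      using has_derivative_mult[OF _ d(1)[unfolded gderiv_def]] unfolding gderiv_def
      by (fastforce simp: mult.commute)
    moreover have "norm (h p *\<^sub>R d) = 1"
    proof -
      have "G p = norm d ^ 2"
        using c(2)[OF p] g_grad[OF d(1)] by (simp add: G_def flat_def)
      then have "h p = 1 / norm d"
        using d(2) by (simp add: h_def powr_minus powr_half_sqrt inverse_eq_divide)
      then show ?thesis using d(2) by simp
    qed
    ultimately show ?thesis by blast
  qed
  have "normalized_defining_function \<Omega> (\<lambda>x. h x * r x)"
    unfolding normalized_defining_function_def defining_function_def
  proof (intro conjI ballI)
    show "smooth (\<lambda>x. h x * r x)" by (intro smooth_mult h_smooth r)
    show "\<Omega> = {z. h z * r z < 0}" unfolding \<Omega> using h_pos by (auto simp: mult_less_0_iff) (metis order.asym)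
    show "\<exists>d. GDERIV (\<lambda>x. h x * r x) p :> d \<and> d \<noteq> 0" if "p \<in> frontier \<Omega>" for p
      using unit[OF that] by fastforce
  qed (rule unit)
  then show ?thesis by (rule that)
qed

section \<open>Hermitian forms and their lowest eigenvalues\<close>

lemma hermitian_inner_add_left: "hermitian_inner (x + y) z = hermitian_inner x z + hermitian_inner y z"
  by (simp add: hermitian_inner_def algebra_simps sum.distrib)

lemma hermitian_inner_scale_left: "hermitian_inner (c *s x) y = c * hermitian_inner x y"
  by (simp add: hermitian_inner_def sum_distrib_left mult.assoc)

lemma hermitian_inner_commute: "cnj (hermitian_inner x y) = hermitian_inner y x"
  by (simp add: hermitian_inner_def cnj_sum mult.commute)

lemma Re_hermitian_inner: "Re (hermitian_inner x y) = x \<bullet> y"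
  by (simp add: hermitian_inner_def inner_vec_def inner_complex_def Re_sum)

lemma Im_hermitian_inner_self: "Im (hermitian_inner x x) = 0"
  by (simp add: hermitian_inner_def Im_sum mult.commute)

lemma hermitian_inner_self: "hermitian_inner x x = complex_of_real ((norm x)\<^sup>2)"
  by (simp add: complex_eq_iff Re_hermitian_inner Im_hermitian_inner_self power2_norm_eq_inner)

lemma norm_cscale: "norm (c *s (x :: complex^'n)) = cmod c * norm x"
proof -
  have "(norm (c *s x))\<^sup>2 = (cmod c * norm x)\<^sup>2"
  proof -
    have "complex_of_real ((norm (c *s x))\<^sup>2) = hermitian_inner (c *s x) (c *s x)"
      by (rule hermitian_inner_self[symmetric])
    also have "\<dots> = c * cnj (c * hermitian_inner x x)"
      by (metis hermitian_inner_commute hermitian_inner_scale_left)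
    also have "\<dots> = complex_of_real ((cmod c * norm x)\<^sup>2)"
      by (simp add: hermitian_inner_self power_mult_distrib mult.assoc[symmetric]
          complex_norm_square[symmetric] del: of_real_power)
    finally show ?thesis using of_real_eq_iff by blast
  qed
  then show ?thesis by simp
qed

definition orthonormal :: "(complex^'n) set \<Rightarrow> bool" where
  "orthonormal S \<longleftrightarrow> (\<forall>x\<in>S. \<forall>y\<in>S. hermitian_inner x y = (if x = y then 1 else 0))"

text \<open>The form lives on the whole space, as the Levi form does in coordinates. The subspace
  \<open>T\<close> enters through the eigenvectors, which are those of the compression of
  \<open>L\<close> to \<open>T\<close>.\<close>

locale hermitian_form =
  fixes L :: "complex^'n \<Rightarrow> complex^'n \<Rightarrow> complex" and T :: "(complex^'n) set"
  assumes add_left: "L (x + y) z = L x z + L y z"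
    and scale_left: "L (c *s x) z = c * L x z"
    and hermitian: "cnj (L x y) = L y x"
    and subspace_T: "vec.subspace T"
begin

lemma add_right: "L z (x + y) = L z x + L z y"
  by (metis add_left hermitian complex_cnj_add)

lemma scale_right: "L z (c *s x) = cnj c * L z x"
  by (metis scale_left hermitian complex_cnj_mult)

lemma zero_left: "L 0 z = 0"
  using add_left[of 0 0 z] by simp

lemma zero_right: "L z 0 = 0"
  using add_right[of z 0 0] by simp

lemma sum_left: "L (\<Sum>i\<in>I. f i) z = (\<Sum>i\<in>I. L (f i) z)"
  by (induction I rule: infinite_finite_induct) (auto simp: zero_left add_left)

lemma sum_right: "L z (\<Sum>i\<in>I. f i) = (\<Sum>i\<in>I. L z (f i))"
  by (induction I rule: infinite_finite_induct) (auto simp: zero_right add_right)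

lemma of_real_Re_self: "complex_of_real (Re (L x x)) = L x x"
  using hermitian[of x x] by (simp add: complex_eq_iff)

definition eigenspace :: "real \<Rightarrow> (complex^'n) set" where
  "eigenspace \<mu> = {\<xi> \<in> T. \<forall>\<eta>\<in>T. L \<xi> \<eta> = complex_of_real \<mu> * hermitian_inner \<xi> \<eta>}"

text \<open>The eigenvalue of a unit eigenvector \<open>e\<close> is \<open>L e e\<close>, so the
  set of vectors determines its eigenvalues and does not have to record them.\<close>

definition eigenvectors :: "(complex^'n) set \<Rightarrow> bool" where
  "eigenvectors S \<longleftrightarrow> finite S \<and> orthonormal S \<and> (\<forall>e\<in>S. e \<in> eigenspace (Re (L e e)))"

end

text \<open>Besides the rules for the right argument, treating the inner product as such a form
  later yields Bessel's identity as a special case.\<close>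

interpretation hermitian_inner: hermitian_form hermitian_inner UNIV
  by unfold_locales (auto simp: hermitian_inner_add_left hermitian_inner_scale_left
      hermitian_inner_commute)

section \<open>Orthonormal systems and orthogonal projection\<close>

definition orth_proj :: "(complex^'n) set \<Rightarrow> complex^'n \<Rightarrow> complex^'n" where
  "orth_proj S x = (\<Sum>s\<in>S. hermitian_inner x s *s s)"

lemma orth_proj_orthogonal:
  assumes "orthonormal S" "finite S" "s \<in> S"
  shows "hermitian_inner (x - orth_proj S x) s = 0"
proof -
  have "hermitian_inner (orth_proj S x) s
      = (\<Sum>r\<in>S. hermitian_inner x r * hermitian_inner r s)"
    by (simp add: orth_proj_def hermitian_inner.sum_left hermitian_inner_scale_left)
  also have "\<dots> = (\<Sum>r\<in>S. if r = s then hermitian_inner x r else 0)"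
    by (rule sum.cong) (use assms in \<open>auto simp: orthonormal_def\<close>)
  also have "\<dots> = hermitian_inner x s"
    using assms by simp
  finally have "hermitian_inner (orth_proj S x) s = hermitian_inner x s" .
  then show ?thesis
    using hermitian_inner_add_left[of "x - orth_proj S x" "orth_proj S x" s] by simp
qed

lemma orth_proj_mem:
  assumes "S \<subseteq> W" "vec.subspace W"
  shows "orth_proj S x \<in> W"
  unfolding orth_proj_def using assms
  by (intro vec.subspace_sum vec.subspace_scale) auto

lemma orthonormal_independent:
  assumes "orthonormal S" "finite S"
  shows "vec.independent S"
proof (rule vec.independent_if_scalars_zero[OF assms(2)])
  fix f x assume f: "(\<Sum>s\<in>S. f s *s s) = 0" and x: "x \<in> S"
  have "0 = hermitian_inner (\<Sum>s\<in>S. f s *s s) x"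
    by (simp add: f hermitian_inner.zero_left)
  also have "\<dots> = (\<Sum>s\<in>S. f s * hermitian_inner s x)"
    by (simp add: hermitian_inner.sum_left hermitian_inner_scale_left)
  also have "\<dots> = (\<Sum>s\<in>S. if s = x then f s else 0)"
    by (rule sum.cong) (use assms x in \<open>auto simp: orthonormal_def\<close>)
  also have "\<dots> = f x" using assms x by simp
  finally show "f x = 0" by simp
qed

lemma orthonormal_card_le_dim:
  assumes "orthonormal S" "finite S" "S \<subseteq> W"
  shows "card S \<le> vec.dim W"
  using vec.independent_card_le_dim[OF assms(3) orthonormal_independent[OF assms(1,2)]] .

text \<open>One Gram-Schmidt step: by dimension some vector of \<open>W\<close> lies outside the
  span of \<open>S\<close>, so its component orthogonal to \<open>S\<close> is nonzero and can be
  normalized.\<close>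

lemma exists_orthogonal_unit_vector:
  assumes S: "orthonormal S" "finite S" "S \<subseteq> W" and W: "vec.subspace W"
    and card: "card S < vec.dim W"
  obtains x where "x \<in> W" "hermitian_inner x x = 1" "\<And>s. s \<in> S \<Longrightarrow> hermitian_inner x s = 0"
proof -
  obtain w where w: "w \<in> W" "w \<notin> vec.span S"
    using vec.dim_le_card[of W S] card S(2) by (meson not_le subsetI)
  define y where "y = w - orth_proj S w"
  have "orth_proj S w \<in> vec.span S"
    by (intro orth_proj_mem vec.subspace_span vec.span_superset)
  then have "y \<noteq> 0" using w by (auto simp: y_def)
  have "y \<in> W"
    unfolding y_def by (intro vec.subspace_diff w W orth_proj_mem S)
  define x where "x = complex_of_real (inverse (norm y)) *s y"
  show ?thesis
  proof
    show "x \<in> W" unfolding x_def using \<open>y \<in> W\<close> W by (rule vec.subspace_scale[rotated])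
    have "norm x = 1"
      using \<open>y \<noteq> 0\<close> by (simp add: x_def norm_cscale norm_inverse)
    then show "hermitian_inner x x = 1" by (simp add: hermitian_inner_self)
    show "hermitian_inner x s = 0" if "s \<in> S" for s
      using orth_proj_orthogonal[OF S(1,2) that, of w]
      by (simp add: x_def hermitian_inner_scale_left flip: y_def)
  qed
qed

lemma orthonormal_insert:
  assumes "orthonormal S" "hermitian_inner x x = 1" "\<And>s. s \<in> S \<Longrightarrow> hermitian_inner x s = 0"
  shows "orthonormal (insert x S)" "x \<notin> S"
proof -
  have "hermitian_inner s x = 0" if "s \<in> S" for s
    using assms(3)[OF that] hermitian_inner_commute[of x s] by simp
  moreover show "x \<notin> S" using assms(2,3) by force
  ultimately show "orthonormal (insert x S)"
    using assms by (auto simp: orthonormal_def)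
qed

section \<open>Orthonormal eigenvectors, multiplicities and the lowest eigenvalues\<close>

context hermitian_form
begin

lemma subspace_eigenspace: "vec.subspace (eigenspace \<mu>)"
  unfolding vec.subspace_def eigenspace_def using subspace_T
  by (auto simp: vec.subspace_def add_left scale_left hermitian_inner_add_left
      hermitian_inner_scale_left hermitian_inner.zero_left zero_left algebra_simps)

lemma eigenspace_subset: "eigenspace \<mu> \<subseteq> T"
  by (auto simp: eigenspace_def)

lemma eigenvectors_subset: "eigenvectors S \<Longrightarrow> S \<subseteq> T"
  using eigenspace_subset by (auto simp: eigenvectors_def)

lemma eigenvalue_unique:
  assumes "e \<in> eigenspace \<mu>" "hermitian_inner e e = 1"
  shows "Re (L e e) = \<mu>"
  using assms by (auto simp: eigenspace_def)

lemma eigenspace_orthogonal: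
  assumes "\<xi> \<in> eigenspace \<mu>" "\<eta> \<in> eigenspace \<nu>" "\<mu> \<noteq> \<nu>"
  shows "hermitian_inner \<xi> \<eta> = 0"
proof -
  have "L \<xi> \<eta> = \<mu> * hermitian_inner \<xi> \<eta>" "L \<eta> \<xi> = \<nu> * hermitian_inner \<eta> \<xi>"
    using assms by (auto simp: eigenspace_def)
  then have "\<mu> * hermitian_inner \<xi> \<eta> = \<nu> * hermitian_inner \<xi> \<eta>"
    using hermitian[of \<eta> \<xi>] hermitian_inner_commute[of \<eta> \<xi>]
    by (metis complex_cnj_mult complex_cnj_complex_of_real)
  then show ?thesis using assms(3) by auto
qed

lemma count_eigenvalues:
  assumes "eigenvectors S"
  shows "count (image_mset (\<lambda>e. Re (L e e)) (mset_set S)) \<mu> = card (S \<inter> eigenspace \<mu>)"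
proof -
  have S: "finite S" using assms by (simp add: eigenvectors_def)
  have "S \<inter> eigenspace \<mu> = {e \<in> S. Re (L e e) = \<mu>}"
    using assms eigenvalue_unique by (auto simp: eigenvectors_def orthonormal_def)
  then show ?thesis
    using S by (simp add: count_image_mset vimage_def Int_def conj_commute)
qed

lemma count_eigenvalues_le:
  assumes "eigenvectors S"
  shows "count (image_mset (\<lambda>e. Re (L e e)) (mset_set S)) \<mu> \<le> vec.dim (eigenspace \<mu>)"
  unfolding count_eigenvalues[OF assms]
  by (rule orthonormal_card_le_dim) (use assms in \<open>auto simp: eigenvectors_def orthonormal_def\<close>)

text \<open>Turns eigenvalues counted with multiplicity into orthonormal eigenvectors. While the
  multiplicity of \<open>\<mu>\<close> is not exhausted, its eigenspace has a unit vector orthogonal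
  to those already chosen in it; the other chosen vectors belong to different real eigenvalues and
  are orthogonal to it anyway.\<close>

lemma eigenvectors_exist:
  assumes "\<And>\<mu>. count M \<mu> \<le> vec.dim (eigenspace \<mu>)"
  shows "\<exists>S. eigenvectors S \<and> M = image_mset (\<lambda>e. Re (L e e)) (mset_set S)"
  using assms
proof (induction M)
  case empty
  then show ?case by (intro exI[of _ "{}"]) (auto simp: eigenvectors_def orthonormal_def)
next
  case (add \<mu> M)
  have "count M \<nu> \<le> vec.dim (eigenspace \<nu>)" for \<nu>
    using add.prems[of \<nu>] by (simp split: if_splits)
  then obtain S where S: "eigenvectors S" "M = image_mset (\<lambda>e. Re (L e e)) (mset_set S)"
    using add.IH by blast
  have S': "finite S" "orthonormal S" "\<And>e. e \<in> S \<Longrightarrow> e \<in> eigenspace (Re (L e e))"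
    using S(1) by (auto simp: eigenvectors_def)
  have "card (S \<inter> eigenspace \<mu>) < vec.dim (eigenspace \<mu>)"
    using add.prems[of \<mu>] count_eigenvalues[OF S(1), of \<mu>] S(2) by simp
  then obtain x where x: "x \<in> eigenspace \<mu>" "hermitian_inner x x = 1"
    "\<And>s. s \<in> S \<inter> eigenspace \<mu> \<Longrightarrow> hermitian_inner x s = 0"
    using exists_orthogonal_unit_vector[OF _ _ _ subspace_eigenspace, of "S \<inter> eigenspace \<mu>" \<mu>] S'
    by (auto simp: orthonormal_def)
  have orth: "hermitian_inner x s = 0" if "s \<in> S" for s
  proof (cases "Re (L s s) = \<mu>")
    case True
    then show ?thesis using x(3)[of s] S'(3)[OF that] that by auto
  next
    case False
    then show ?thesis using eigenspace_orthogonal x(1) S'(3)[OF that] by metis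
  qed
  note ins = orthonormal_insert[OF S'(2) x(2) orth]
  have "Re (L x x) = \<mu>" using eigenvalue_unique x by blast
  then show ?case
    using ins S' x(1) S(2) by (intro exI[of _ "insert x S"]) (auto simp: eigenvectors_def)
qed

lemma eigenvectors_apply:
  assumes "eigenvectors S" "e \<in> S" "\<eta> \<in> T"
  shows "L e \<eta> = Re (L e e) * hermitian_inner e \<eta>"
proof -
  have "e \<in> eigenspace (Re (L e e))" using assms by (simp add: eigenvectors_def)
  with assms(3) show ?thesis unfolding eigenspace_def by blast
qed

lemma eigenvectors_proj_left:
  assumes "eigenvectors S" "\<eta> \<in> T"
  shows "L (orth_proj S v) \<eta> = (\<Sum>e\<in>S. hermitian_inner v e * Re (L e e) * hermitian_inner e \<eta>)"
  unfolding orth_proj_def sum_left scale_left mult.assoc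
  by (intro sum.cong refl arg_cong[where f = "(*) _"] eigenvectors_apply[OF assms(1) _ assms(2)])

text \<open>The span of \<open>S\<close> and its orthogonal complement in \<open>T\<close> are
  orthogonal for \<open>L\<close> too, because \<open>L e x\<close> is a multiple of the inner
  product of \<open>e\<close> and \<open>x\<close>. Hence the mixed terms vanish.\<close>

lemma form_decompose:
  assumes S: "eigenvectors S" and v: "v \<in> T"
  shows "Re (L v v) = (\<Sum>e\<in>S. Re (L e e) * (cmod (hermitian_inner v e))\<^sup>2)
           + Re (L (v - orth_proj S v) (v - orth_proj S v))"
proof -
  define p x where "p = orth_proj S v" and "x = v - p"
  have S': "finite S" "orthonormal S" using S by (auto simp: eigenvectors_def)
  have pT: "p \<in> T"
    unfolding p_def by (intro orth_proj_mem subspace_T eigenvectors_subset S)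
  have xT: "x \<in> T" unfolding x_def by (intro vec.subspace_diff subspace_T v pT)
  have xe: "hermitian_inner e x = 0" "hermitian_inner x e = 0" if "e \<in> S" for e
    using orth_proj_orthogonal[OF S'(2,1) that, of v] hermitian_inner_commute[of x e]
    by (simp_all add: x_def p_def)
  have px: "L p x = 0"
    using eigenvectors_proj_left[OF S xT] by (simp add: p_def xe)
  then have xp: "L x p = 0" using hermitian[of p x] by simp
  have ep: "hermitian_inner e p = cnj (hermitian_inner v e)" if "e \<in> S" for e
  proof -
    have "hermitian_inner e p = hermitian_inner e v"
      using hermitian_inner.add_right[of e x p] xe[OF that] by (simp add: x_def)
    then show ?thesis by (simp add: hermitian_inner_commute)
  qed
  have "L p p = (\<Sum>e\<in>S. hermitian_inner v e * Re (L e e) * cnj (hermitian_inner v e))"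
    using eigenvectors_proj_left[OF S pT, of v] by (simp add: p_def[symmetric] ep)
  also have "\<dots> = (\<Sum>e\<in>S. complex_of_real (Re (L e e) * (cmod (hermitian_inner v e))\<^sup>2))"
    by (rule sum.cong) (simp_all add: complex_norm_square mult_ac del: of_real_power)
  finally have "Re (L p p) = (\<Sum>e\<in>S. Re (L e e) * (cmod (hermitian_inner v e))\<^sup>2)"
    by (simp add: Re_sum)
  moreover have "v = x + p" by (simp add: x_def)
  then have "L v v = L p p + L x x"
    by (simp add: add_left add_right px xp)
  ultimately show ?thesis by (simp add: x_def p_def)
qed

text \<open>Rayleigh's principle: a minimizer of the form on the unit sphere of the orthogonal
  complement \<open>V\<close> of \<open>S\<close> in \<open>T\<close> exists by compactness, and the
  first variation there shows that it is an eigenvector.\<close>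

lemma eigenvector_extend:
  assumes S: "eigenvectors S" and card: "card S < vec.dim T" and T: "closed T"
    and cont: "continuous_on UNIV (\<lambda>x. Re (L x x))"
    and minimal: "\<And>e x. e \<in> S \<Longrightarrow> x \<in> T \<Longrightarrow> (\<And>s. s \<in> S \<Longrightarrow> hermitian_inner x s = 0) \<Longrightarrow>
                   Re (L e e) * (norm x)\<^sup>2 \<le> Re (L x x)"
  obtains e where "e \<notin> S" "eigenvectors (insert e S)"
    "\<And>x. x \<in> T \<Longrightarrow> (\<And>s. s \<in> S \<Longrightarrow> hermitian_inner x s = 0) \<Longrightarrow> Re (L e e) * (norm x)\<^sup>2 \<le> Re (L x x)"
proof -
  have S': "finite S" "orthonormal S" "S \<subseteq> T"
    using S eigenvectors_subset by (auto simp: eigenvectors_def)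
  note eig = eigenvectors_apply[OF S]
  define V where "V = {x \<in> T. \<forall>s\<in>S. hermitian_inner x s = 0}"
  have V: "vec.subspace V" using subspace_T unfolding V_def vec.subspace_def
    by (auto simp: hermitian_inner_add_left hermitian_inner_scale_left hermitian_inner.zero_left)
  have "continuous_on UNIV (\<lambda>x. hermitian_inner x s)" for s
    unfolding hermitian_inner_def by (intro continuous_intros)
  moreover have "V = T \<inter> (\<Inter>s\<in>S. {x. hermitian_inner x s = 0})" by (auto simp: V_def)
  ultimately have "closed V"
    using T by (auto intro!: closed_Int closed_INT closed_Collect_eq continuous_on_const)
  then have compact: "compact (V \<inter> sphere 0 1)" by (simp add: closed_Int_compact)
  obtain x0 where "x0 \<in> T" "hermitian_inner x0 x0 = 1" "\<And>s. s \<in> S \<Longrightarrow> hermitian_inner x0 s = 0"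
    using exists_orthogonal_unit_vector[OF S'(2,1,3) subspace_T card] by blast
  then have "x0 \<in> V \<inter> sphere 0 1"
    by (auto simp: V_def hermitian_inner_self complex_eq_iff power2_eq_1_iff)
       (smt (verit) norm_ge_zero)
  then have "V \<inter> sphere 0 1 \<noteq> {}" by blast
  from continuous_attains_inf[OF compact this continuous_on_subset[OF cont subset_UNIV]]
  obtain e where e: "e \<in> V" "norm e = 1"
    and e_min: "\<And>x. x \<in> V \<Longrightarrow> norm x = 1 \<Longrightarrow> Re (L e e) \<le> Re (L x x)"
    by auto
  define l where "l = Re (L e e)"
  have min: "l * (norm x)\<^sup>2 \<le> Re (L x x)" if "x \<in> V" for x
  proof (cases "x = 0")
    case False
    define y where "y = complex_of_real (inverse (norm x)) *s x"
    have "y \<in> V" unfolding y_def using V that by (rule vec.subspace_scale)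
    moreover have "norm y = 1" using False by (simp add: y_def norm_cscale norm_inverse)
    ultimately have "l \<le> Re (L y y)" using e_min l_def by blast
    also have "Re (L y y) = Re (L x x) / (norm x)\<^sup>2"
      by (simp add: y_def scale_left scale_right power2_eq_square field_simps del: of_real_inverse)
    finally show ?thesis using False by (simp add: field_simps)
  qed (simp add: zero_left)
  have ee: "hermitian_inner e e = 1" using e by (simp add: hermitian_inner_self)
  have eV: "L e \<eta> = l * hermitian_inner e \<eta>" if \<eta>: "\<eta> \<in> V" for \<eta>
  proof (rule ccontr)
    assume neq: "L e \<eta> \<noteq> l * hermitian_inner e \<eta>"
    \<comment> \<open>The form \<open>Q\<close> below is non-negative on \<open>V\<close> and
      vanishes at \<open>e\<close>, so it is affine along any real line through
      \<open>\<eta>\<close> in a complex multiple of the direction \<open>e\<close>. If the residue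
      \<open>b\<close> were nonzero, the slope \<open>- 2 * (cmod b)^2\<close> in direction
      \<open>- (b *s e)\<close> would make \<open>Q\<close> negative far out.\<close>
    define b where "b = L \<eta> e - l * hermitian_inner \<eta> e"
    have b: "cnj b = L e \<eta> - l * hermitian_inner e \<eta>"
      by (simp add: b_def hermitian hermitian_inner_commute)
    then have "b \<noteq> 0" using neq by auto
    define Q where "Q x = Re (L x x) - l * (norm x)\<^sup>2" for x
    have Q_eq: "Q x = Re (L x x - l * hermitian_inner x x)" for x
      by (simp add: Q_def hermitian_inner_self)
    have Q: "Q (\<eta> + complex_of_real (-s) *s (b *s e)) = Q \<eta> - 2 * s * (cmod b)\<^sup>2" for s
    proof -
      define c where "c = complex_of_real (-s) * b"
      have "L (\<eta> + c *s e) (\<eta> + c *s e) - l * hermitian_inner (\<eta> + c *s e) (\<eta> + c *s e)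
          = (L \<eta> \<eta> - l * hermitian_inner \<eta> \<eta>) + cnj c * b + c * cnj b
            + c * cnj c * (L e e - l * hermitian_inner e e)"
        unfolding b unfolding b_def
        by (simp add: add_left add_right scale_left scale_right hermitian_inner.add_left
            hermitian_inner.add_right hermitian_inner.scale_left hermitian_inner.scale_right
            algebra_simps)
      also have "L e e - l * hermitian_inner e e = 0"
        using of_real_Re_self[of e] by (simp add: ee l_def)
      also have "cnj c * b = - (s * (b * cnj b))"
        by (simp add: c_def mult_ac)
      also have "c * cnj b = - (s * (b * cnj b))"
        by (simp add: c_def mult_ac)
      also have "b * cnj b = complex_of_real ((cmod b)\<^sup>2)"
        by (rule complex_norm_square[symmetric])
      finally show ?thesis
        unfolding Q_eq c_def vector_smult_assoc by simp
    qed
    have "Q (\<eta> + complex_of_real (-s) *s (b *s e)) \<ge> 0" for s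
      unfolding Q_def using min by (simp only: diff_ge_0_iff_ge)
        (intro min vec.subspace_add vec.subspace_scale V \<eta> e)
    then have "Q \<eta> - 2 * s * (cmod b)\<^sup>2 \<ge> 0" for s using Q by simp
    \<comment> \<open>With this \<open>s\<close> the lower bound reads
      \<open>-1 \<ge> 0\<close>.\<close>
    from this[of "(Q \<eta> + 1) / (2 * (cmod b)\<^sup>2)"] show False
      using \<open>b \<noteq> 0\<close> by simp
  qed
  \<comment> \<open>From \<open>V\<close> to \<open>T\<close>: on the span of \<open>S\<close> both
    sides vanish, the left one because each \<open>s\<close> is an eigenvector orthogonal to
    \<open>e\<close>.\<close>
  have "L e \<eta> = l * hermitian_inner e \<eta>" if \<eta>: "\<eta> \<in> T" for \<eta>
  proof -
    have "\<eta> - orth_proj S \<eta> \<in> V"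
      unfolding V_def using orth_proj_orthogonal[OF S'(2,1)]
      by (auto intro!: vec.subspace_diff subspace_T orth_proj_mem S' \<eta>)
    note 1 = eV[OF this]
    have es: "hermitian_inner e s = 0" if "s \<in> S" for s using e that by (simp add: V_def)
    have "L e s = 0" if "s \<in> S" for s
    proof -
      have "L s e = Re (L s s) * hermitian_inner s e"
        using eig that e by (simp add: V_def)
      also have "hermitian_inner s e = 0"
        using es[OF that] hermitian_inner_commute[of e s] by simp
      finally show ?thesis using hermitian[of s e] by simp
    qed
    then have "L e (orth_proj S \<eta>) = 0" "hermitian_inner e (orth_proj S \<eta>) = 0"
      using es by (simp_all add: orth_proj_def sum_right scale_right hermitian_inner.sum_right
          hermitian_inner.scale_right)
    then show ?thesis
      using 1 add_right[of e "\<eta> - orth_proj S \<eta>" "orth_proj S \<eta>"]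
        hermitian_inner.add_right[of e "\<eta> - orth_proj S \<eta>" "orth_proj S \<eta>"] by simp
  qed
  then have "e \<in> eigenspace (Re (L e e))"
    using e unfolding eigenspace_def l_def[symmetric] by (simp add: V_def)
  moreover have "orthonormal (insert e S)" "e \<notin> S"
    using orthonormal_insert[OF S'(2) ee] e by (auto simp: V_def)
  ultimately show ?thesis
    using S min by (intro that[of e]) (simp_all add: eigenvectors_def V_def l_def)
qed

text \<open>Greedy choice: each new eigenvector minimizes the form on the complement of the previous
  ones. The bound for an earlier eigenvector persists because the complement only shrinks.\<close>

lemma lowest_eigenvectors_exist:
  assumes T: "closed T" and cont: "continuous_on UNIV (\<lambda>x. Re (L x x))"
  shows "k \<le> vec.dim T \<Longrightarrow> \<exists>S. card S = k \<and> eigenvectors S \<and>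
     (\<forall>e\<in>S. \<forall>x\<in>T. (\<forall>s\<in>S. hermitian_inner x s = 0) \<longrightarrow> Re (L e e) * (norm x)\<^sup>2 \<le> Re (L x x))"
proof (induction k)
  case 0
  then show ?case by (intro exI[of _ "{}"]) (auto simp: eigenvectors_def orthonormal_def)
next
  case (Suc k)
  then obtain S where S: "card S = k" "eigenvectors S"
    and m: "\<And>e x. e \<in> S \<Longrightarrow> x \<in> T \<Longrightarrow> (\<And>s. s \<in> S \<Longrightarrow> hermitian_inner x s = 0) \<Longrightarrow>
              Re (L e e) * (norm x)\<^sup>2 \<le> Re (L x x)"
    by auto
  have "card S < vec.dim T" using S Suc.prems by simp
  from eigenvector_extend[OF S(2) this T cont m] obtain e where e: "e \<notin> S" "eigenvectors (insert e S)"
    "\<And>x. x \<in> T \<Longrightarrow> (\<And>s. s \<in> S \<Longrightarrow> hermitian_inner x s = 0) \<Longrightarrow> Re (L e e) * (norm x)\<^sup>2 \<le> Re (L x x)"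
    by blast
  have "finite S" using S(2) by (simp add: eigenvectors_def)
  then show ?case
  proof (intro exI[of _ "insert e S"] conjI ballI impI)
    show "card (insert e S) = Suc k" using e(1) S(1) \<open>finite S\<close> by simp
    show "Re (L s s) * (norm x)\<^sup>2 \<le> Re (L x x)"
      if "s \<in> insert e S" "x \<in> T" "\<forall>s\<in>insert e S. hermitian_inner x s = 0" for s x
      using that e(3)[of x] m[of s x] by blast
  qed (rule e(2))
qed

end

text \<open>This is \<open>form_decompose\<close> for the inner product itself, of which every
  vector is an eigenvector with eigenvalue 1.\<close>

lemma bessel_inequality:
  assumes "orthonormal F" "finite F"
  shows "(\<Sum>v\<in>F. (cmod (hermitian_inner x v))\<^sup>2) + (norm (x - orth_proj F x))\<^sup>2 = (norm x)\<^sup>2"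
proof -
  have F: "hermitian_inner v v = 1" if "v \<in> F" for v
    using assms that by (simp add: orthonormal_def)
  have "hermitian_inner.eigenvectors F"
    unfolding hermitian_inner.eigenvectors_def hermitian_inner.eigenspace_def
    using assms by (simp add: F)
  from hermitian_inner.form_decompose[OF this, of x]
  have "Re (hermitian_inner x x) = (\<Sum>v\<in>F. (cmod (hermitian_inner x v))\<^sup>2)
      + Re (hermitian_inner (x - orth_proj F x) (x - orth_proj F x))"
    by (simp add: F)
  then show ?thesis
    by (simp only: Re_hermitian_inner power2_norm_eq_inner)
qed

section \<open>Ky Fan's minimum principle\<close>

context hermitian_form
begin

text \<open>The weights \<open>c v e\<close> distribute each \<open>v\<close> over \<open>S\<close>,
  and the rest of \<open>v\<close> costs at least the largest eigenvalue \<open>m\<close> of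
  \<open>S\<close>. By Bessel each \<open>e\<close> receives a total weight \<open>w e\<close> of at
  most 1. What it lacks is paid at the rate \<open>m\<close>, which is not below its own
  eigenvalue.\<close>

lemma trace_ge_lowest_eigenvalues:
  assumes S: "eigenvectors S" and F: "orthonormal F" "finite F" "F \<subseteq> T" and card: "card F = card S"
    and minimal: "\<And>e x. e \<in> S \<Longrightarrow> x \<in> T \<Longrightarrow> (\<And>s. s \<in> S \<Longrightarrow> hermitian_inner x s = 0) \<Longrightarrow>
                   Re (L e e) * (norm x)\<^sup>2 \<le> Re (L x x)"
  shows "(\<Sum>e\<in>S. Re (L e e)) \<le> (\<Sum>v\<in>F. Re (L v v))"
proof (cases "S = {}")
  case False
  have S': "finite S" "orthonormal S" "S \<subseteq> T"
    using S eigenvectors_subset by (auto simp: eigenvectors_def)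
  define m where "m = (MAX e\<in>S. Re (L e e))"
  have m: "Re (L e e) \<le> m" if "e \<in> S" for e
    unfolding m_def using that S' by (intro Max_ge) auto
  have "m \<in> (\<lambda>e. Re (L e e)) ` S" unfolding m_def using S' False by (intro Max_in) auto
  then obtain e0 where e0: "e0 \<in> S" "m = Re (L e0 e0)" by auto
  define c where "c v e = (cmod (hermitian_inner v e))\<^sup>2" for v e :: "complex^'n"
  have low: "(\<Sum>e\<in>S. Re (L e e) * c v e) + m * (1 - (\<Sum>e\<in>S. c v e)) \<le> Re (L v v)" if v: "v \<in> F" for v
  proof -
    let ?x = "v - orth_proj S v"
    have vT: "v \<in> T" using v F by auto
    have "?x \<in> T" by (intro vec.subspace_diff subspace_T vT orth_proj_mem S')
    then have "m * (norm ?x)\<^sup>2 \<le> Re (L ?x ?x)"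
      unfolding e0(2) using orth_proj_orthogonal[OF S'(2,1)] by (intro minimal e0(1)) auto
    moreover have "(norm v)\<^sup>2 = 1"
      using F(1) v by (simp add: orthonormal_def Re_hermitian_inner[symmetric] power2_norm_eq_inner)
    then have "(norm ?x)\<^sup>2 = 1 - (\<Sum>e\<in>S. c v e)"
      using bessel_inequality[OF S'(2,1), of v] by (simp add: c_def)
    ultimately show ?thesis
      using form_decompose[OF S vT] by (simp add: c_def)
  qed
  have w_le: "(\<Sum>v\<in>F. c v e) \<le> 1" if "e \<in> S" for e
  proof -
    have "(norm e)\<^sup>2 = 1"
      using S'(2) that by (simp add: orthonormal_def Re_hermitian_inner[symmetric] power2_norm_eq_inner)
    then have "(\<Sum>v\<in>F. c e v) = 1 - (norm (e - orth_proj F e))\<^sup>2"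
      using bessel_inequality[OF F(1,2), of e] by (simp add: c_def)
    also have "\<dots> \<le> 1" by simp
    finally have "(\<Sum>v\<in>F. c e v) \<le> 1" .
    moreover have "c e v = c v e" for v
      unfolding c_def by (metis complex_mod_cnj hermitian_inner_commute)
    ultimately show ?thesis by simp
  qed
  define w where "w e = (\<Sum>v\<in>F. c v e)" for e
  have "(\<Sum>v\<in>F. \<Sum>e\<in>S. Re (L e e) * c v e) = (\<Sum>e\<in>S. Re (L e e) * w e)"
    unfolding w_def by (subst sum.swap) (simp add: sum_distrib_left)
  moreover have "(\<Sum>v\<in>F. \<Sum>e\<in>S. c v e) = (\<Sum>e\<in>S. w e)"
    unfolding w_def by (rule sum.swap)
  \<comment> \<open>Since \<open>card F = card S\<close>, the total weight lying outside
    \<open>S\<close> is the sum of \<open>1 - w e\<close> over \<open>S\<close>.\<close>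
  ultimately have
    "(\<Sum>v\<in>F. (\<Sum>e\<in>S. Re (L e e) * c v e) + m * (1 - (\<Sum>e\<in>S. c v e))) - (\<Sum>e\<in>S. Re (L e e))
      = (\<Sum>e\<in>S. (m - Re (L e e)) * (1 - w e))"
    using card by (simp add: algebra_simps sum.distrib sum_subtractf flip: sum_distrib_left)
  also have "\<dots> \<ge> 0"
    using m w_le by (intro sum_nonneg mult_nonneg_nonneg) (auto simp: w_def)
  finally have "0 \<le> (\<Sum>v\<in>F. (\<Sum>e\<in>S. Re (L e e) * c v e) + m * (1 - (\<Sum>e\<in>S. c v e))) - (\<Sum>e\<in>S. Re (L e e))" .
  also have "\<dots> \<le> (\<Sum>v\<in>F. Re (L v v)) - (\<Sum>e\<in>S. Re (L e e))"
    using low by (intro diff_right_mono sum_mono)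
  finally show ?thesis by simp
next
  case True
  with card F(2) show ?thesis by simp
qed

text \<open>The trace over \<open>F\<close> is bounded below by the sum of the \<open>q\<close>
  lowest eigenvalues; conversely, the eigenvectors that realize \<open>M\<close> form a frame whose
  trace is the sum of \<open>M\<close>. Unlike eigenvalues, traces are easy to compare between forms
  and to follow along converging points.\<close>

lemma eigenvalue_sums_nonneg_iff:
  assumes "closed T" "continuous_on UNIV (\<lambda>x. Re (L x x))"
  shows "(\<forall>M. size M = q \<and> (\<forall>\<mu>. count M \<mu> \<le> vec.dim (eigenspace \<mu>)) \<longrightarrow> 0 \<le> sum_mset M) \<longleftrightarrow>
    (\<forall>F. finite F \<and> card F = q \<and> F \<subseteq> T \<and> orthonormal F \<longrightarrow> 0 \<le> (\<Sum>v\<in>F. Re (L v v)))"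
    (is "?lhs \<longleftrightarrow> ?rhs")
proof
  assume eigen: ?lhs
  show ?rhs
  proof (intro allI impI, elim conjE)
    fix F assume F: "finite F" "card F = q" "F \<subseteq> T" "orthonormal F"
    then have "q \<le> vec.dim T" using orthonormal_card_le_dim by blast
    from lowest_eigenvectors_exist[OF assms this] obtain S where S: "card S = q" "eigenvectors S"
      and min: "\<And>e x. e \<in> S \<Longrightarrow> x \<in> T \<Longrightarrow> (\<And>s. s \<in> S \<Longrightarrow> hermitian_inner x s = 0) \<Longrightarrow>
              Re (L e e) * (norm x)\<^sup>2 \<le> Re (L x x)" by blast
    have "0 \<le> sum_mset (image_mset (\<lambda>e. Re (L e e)) (mset_set S))"
      using eigen S(1) count_eigenvalues_le[OF S(2)] by simp
    also have "\<dots> = (\<Sum>e\<in>S. Re (L e e))" by (simp add: sum_unfold_sum_mset)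
    also have "\<dots> \<le> (\<Sum>v\<in>F. Re (L v v))"
    proof (rule trace_ge_lowest_eigenvalues[OF S(2) F(4,1,3)])
      show "card F = card S" using F(2) S(1) by simp
    qed (rule min)
    finally show "0 \<le> (\<Sum>v\<in>F. Re (L v v))" .
  qed
next
  assume trace: ?rhs
  show ?lhs
  proof (intro allI impI, elim conjE)
    fix M assume M: "size M = q" "\<forall>\<mu>. count M \<mu> \<le> vec.dim (eigenspace \<mu>)"
    from eigenvectors_exist[OF M(2)[rule_format]]
    obtain S where S: "eigenvectors S" "M = image_mset (\<lambda>e. Re (L e e)) (mset_set S)"
      by blast
    moreover have "0 \<le> (\<Sum>v\<in>S. Re (L v v))"
      using trace S M(1) eigenvectors_subset[OF S(1)] by (simp add: eigenvectors_def)
    ultimately show "0 \<le> sum_mset M" by (simp add: sum_unfold_sum_mset)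
  qed
qed

end

section \<open>Second derivatives and the Levi form\<close>

definition hessian :: "('a::euclidean_space \<Rightarrow> real) \<Rightarrow> 'a \<Rightarrow> 'a \<Rightarrow> 'a \<Rightarrow> real" where
  "hessian f x u v = frechet_derivative (\<lambda>y. frechet_derivative f (at y) u) (at x) v"

definition gradient :: "('a::euclidean_space \<Rightarrow> real) \<Rightarrow> 'a \<Rightarrow> 'a" where
  "gradient f x = (\<Sum>b\<in>Basis. frechet_derivative f (at x) b *\<^sub>R b)"

lemma smooth_linear_derivative: "smooth f \<Longrightarrow> linear (frechet_derivative f (at x))"
  using smooth_has_derivative has_derivative_linear by blast

lemma smooth_derivative_gradient:
  fixes f :: "'a::euclidean_space \<Rightarrow> real"
  assumes "smooth f"
  shows "frechet_derivative f (at x) v = v \<bullet> gradient f x"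
proof -
  interpret linear "frechet_derivative f (at x)" using assms by (rule smooth_linear_derivative)
  have "frechet_derivative f (at x) v = frechet_derivative f (at x) (\<Sum>b\<in>Basis. (v \<bullet> b) *\<^sub>R b)"
    by (simp add: euclidean_representation)
  also have "\<dots> = v \<bullet> gradient f x"
    by (simp add: sum scale gradient_def inner_sum_right mult.commute)
  finally show ?thesis .
qed

lemma gderiv_unique: "GDERIV f x :> d \<Longrightarrow> GDERIV f x :> e \<Longrightarrow> d = e"
proof -
  assume "GDERIV f x :> d" "GDERIV f x :> e"
  then have "(\<lambda>h. h \<bullet> d) = (\<lambda>h. h \<bullet> e)"
    unfolding gderiv_def by (rule has_derivative_unique)
  then have "\<forall>h. h \<bullet> d = h \<bullet> e" by (auto dest: fun_cong)
  then show "d = e" by (simp only: vector_eq_ldot)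
qed

lemma smooth_gderiv:
  fixes f :: "'a::euclidean_space \<Rightarrow> real"
  assumes "smooth f"
  shows "GDERIV f x :> gradient f x"
proof -
  have "frechet_derivative f (at x) = (\<lambda>h. h \<bullet> gradient f x)"
    using smooth_derivative_gradient[OF assms] by (intro ext)
  then show ?thesis
    using smooth_has_derivative[OF assms, of x] by (simp only: gderiv_def)
qed

lemma continuous_gradient: "smooth f \<Longrightarrow> continuous_on UNIV (gradient f)"
  unfolding gradient_def
  by (intro continuous_intros smooth_continuous smooth_derivative)

lemma hessian_has_derivative:
  "smooth f \<Longrightarrow> ((\<lambda>y. frechet_derivative f (at y) u) has_derivative hessian f x u) (at x)"
  unfolding hessian_def using smooth_has_derivative[OF smooth_derivative] by blast

lemma linear_hessian_right: "smooth f \<Longrightarrow> linear (hessian f x u)"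
  using hessian_has_derivative has_derivative_linear by blast

lemma linear_hessian_left:
  assumes f: "smooth f"
  shows "linear (\<lambda>u. hessian f x u v)"
proof
  fix u w
  have "(\<lambda>y. frechet_derivative f (at y) (u + w))
      = (\<lambda>y. frechet_derivative f (at y) u + frechet_derivative f (at y) w)"
    using linear_add[OF smooth_linear_derivative[OF f]] by blast
  then have "hessian f x (u + w) = (\<lambda>v. hessian f x u v + hessian f x w v)"
    using has_derivative_unique[OF hessian_has_derivative[OF f, of "u + w" x]]
      has_derivative_add[OF hessian_has_derivative[OF f, of u x] hessian_has_derivative[OF f, of w x]]
    by simp
  then show "hessian f x (u + w) v = hessian f x u v + hessian f x w v" by simp
next
  fix c u
  have "(\<lambda>y. frechet_derivative f (at y) (c *\<^sub>R u)) = (\<lambda>y. c *\<^sub>R frechet_derivative f (at y) u)"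
    using linear_scale[OF smooth_linear_derivative[OF f]] by blast
  then have "hessian f x (c *\<^sub>R u) = (\<lambda>v. c *\<^sub>R hessian f x u v)"
    using has_derivative_unique[OF hessian_has_derivative[OF f, of "c *\<^sub>R u" x]]
      has_derivative_scaleR_right[OF hessian_has_derivative[OF f, of u x], of c] by simp
  then show "hessian f x (c *\<^sub>R u) v = c *\<^sub>R hessian f x u v" by simp
qed

lemma continuous_hessian: "smooth f \<Longrightarrow> continuous_on UNIV (\<lambda>x. hessian f x u v)"
  unfolding hessian_def by (intro smooth_continuous smooth_derivative)

lemma smooth_line_derivative:
  fixes f :: "'a::euclidean_space \<Rightarrow> real"
  assumes "smooth f"
  shows "((\<lambda>t. f (x + t *\<^sub>R u)) has_real_derivative frechet_derivative f (at (x + t *\<^sub>R u)) u) (at t)"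
proof -
  have "((\<lambda>t. x + t *\<^sub>R u) has_derivative (\<lambda>h. h *\<^sub>R u)) (at t)"
    by (auto intro!: derivative_eq_intros)
  from has_derivative_compose[OF this smooth_has_derivative[OF assms]]
  show ?thesis
    by (rule has_derivative_imp_has_field_derivative)
       (simp add: linear_scale[OF smooth_linear_derivative[OF assms]])
qed

text \<open>The mean value theorem is applied first along \<open>u\<close> to the increment of
  \<open>f\<close> by \<open>h *\<^sub>R v\<close>, then along \<open>v\<close> to the derivative in
  direction \<open>u\<close>.\<close>

lemma second_difference:
  fixes f :: "'a::euclidean_space \<Rightarrow> real"
  assumes f: "smooth f" and h: "h > 0"
  obtains s t where "0 < s" "s < h" "0 < t" "t < h"
    "f (x + h *\<^sub>R u + h *\<^sub>R v) - f (x + h *\<^sub>R u) - (f (x + h *\<^sub>R v) - f x)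
       = h\<^sup>2 * hessian f (x + s *\<^sub>R u + t *\<^sub>R v) u v"
proof -
  define F where "F s = f (x + h *\<^sub>R v + s *\<^sub>R u) - f (x + s *\<^sub>R u)" for s
  define F' where "F' s = frechet_derivative f (at (x + h *\<^sub>R v + s *\<^sub>R u)) u
    - frechet_derivative f (at (x + s *\<^sub>R u)) u" for s
  have "(F has_real_derivative F' s) (at s)" for s
    unfolding F_def F'_def by (intro DERIV_diff smooth_line_derivative f)
  from MVT2[OF h this] obtain s where s: "0 < s" "s < h" "F h - F 0 = h * F' s"
    by auto
  have "((\<lambda>t. frechet_derivative f (at (x + s *\<^sub>R u + t *\<^sub>R v)) u) has_real_derivative
      hessian f (x + s *\<^sub>R u + t *\<^sub>R v) u v) (at t)" for t
    unfolding hessian_def by (rule smooth_line_derivative[OF smooth_derivative[OF f]])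
  from MVT2[OF h this] obtain t where t: "0 < t" "t < h"
    "frechet_derivative f (at (x + s *\<^sub>R u + h *\<^sub>R v)) u - frechet_derivative f (at (x + s *\<^sub>R u)) u
      = h * hessian f (x + s *\<^sub>R u + t *\<^sub>R v) u v"
    by auto
  have "F' s = h * hessian f (x + s *\<^sub>R u + t *\<^sub>R v) u v"
    unfolding F'_def t(3)[symmetric] by (simp add: add_ac)
  then have "F h - F 0 = h\<^sup>2 * hessian f (x + s *\<^sub>R u + t *\<^sub>R v) u v"
    using s by (simp add: power2_eq_square)
  moreover have "F h - F 0
      = f (x + h *\<^sub>R u + h *\<^sub>R v) - f (x + h *\<^sub>R u) - (f (x + h *\<^sub>R v) - f x)"
    by (simp add: F_def add_ac)
  ultimately show ?thesis using that s t by metis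
qed

text \<open>Schwarz's theorem. The second difference is symmetric in \<open>u\<close> and
  \<open>v\<close>, so the two mixed derivatives agree at points arbitrarily close to
  \<open>x\<close>, and continuity carries this to \<open>x\<close>.\<close>

lemma hessian_symmetric:
  fixes f :: "'a::euclidean_space \<Rightarrow> real"
  assumes f: "smooth f"
  shows "hessian f x u v = hessian f x v u"
proof (rule ccontr)
  assume neq: "hessian f x u v \<noteq> hessian f x v u"
  define e where "e = dist (hessian f x u v) (hessian f x v u) / 2"
  have e: "e > 0" using neq by (simp add: e_def)
  have cont: "isCont (\<lambda>y. hessian f y a b) x" for a b
    using continuous_hessian[OF f] by (simp add: continuous_on_eq_continuous_at)
  obtain d1 where d1: "d1 > 0" "\<And>y. dist y x < d1 \<Longrightarrow> dist (hessian f y u v) (hessian f x u v) < e"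
    using cont[of u v] e unfolding continuous_at_eps_delta by blast
  obtain d2 where d2: "d2 > 0" "\<And>y. dist y x < d2 \<Longrightarrow> dist (hessian f y v u) (hessian f x v u) < e"
    using cont[of v u] e unfolding continuous_at_eps_delta by blast
  \<comment> \<open>Steps shorter than \<open>h\<close> along \<open>u\<close> and \<open>v\<close>
    stay within both \<open>d1\<close> and \<open>d2\<close> of \<open>x\<close>; the summand 1
    keeps the denominator positive.\<close>
  define h where "h = min d1 d2 / (norm u + norm v + 1)"
  have pos: "norm u + norm v + 1 > 0" by (simp add: add_nonneg_pos)
  have h: "h > 0" using d1 d2 pos by (simp add: h_def)
  have near: "dist (x + s *\<^sub>R a + t *\<^sub>R b) x < min d1 d2"
    if "0 < s" "s < h" "0 < t" "t < h" "norm a + norm b = norm u + norm v" for s t a b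
  proof -
    have "dist (x + s *\<^sub>R a + t *\<^sub>R b) x = norm (s *\<^sub>R a + t *\<^sub>R b)"
      by (simp add: dist_norm)
    also have "\<dots> \<le> s * norm a + t * norm b"
      using norm_triangle_ineq[of "s *\<^sub>R a" "t *\<^sub>R b"] that by simp
    also have "\<dots> \<le> h * norm a + h * norm b"
      using that by (intro add_mono mult_right_mono) auto
    also have "\<dots> = h * (norm u + norm v)"
      using that(5) by (simp flip: distrib_left)
    also have "\<dots> < h * (norm u + norm v + 1)" using h by simp
    also have "\<dots> = min d1 d2" using pos by (simp add: h_def)
    finally show ?thesis .
  qed
  obtain s t where st: "0 < s" "s < h" "0 < t" "t < h"
    "f (x + h *\<^sub>R u + h *\<^sub>R v) - f (x + h *\<^sub>R u) - (f (x + h *\<^sub>R v) - f x)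
       = h\<^sup>2 * hessian f (x + s *\<^sub>R u + t *\<^sub>R v) u v"
    using second_difference[OF f h] .
  obtain s' t' where st': "0 < s'" "s' < h" "0 < t'" "t' < h"
    "f (x + h *\<^sub>R v + h *\<^sub>R u) - f (x + h *\<^sub>R v) - (f (x + h *\<^sub>R u) - f x)
       = h\<^sup>2 * hessian f (x + s' *\<^sub>R v + t' *\<^sub>R u) v u"
    using second_difference[OF f h] .
  have swap: "x + h *\<^sub>R v + h *\<^sub>R u = x + h *\<^sub>R u + h *\<^sub>R v" by simp
  have "h\<^sup>2 * hessian f (x + s *\<^sub>R u + t *\<^sub>R v) u v = h\<^sup>2 * hessian f (x + s' *\<^sub>R v + t' *\<^sub>R u) v u"
    using st(5) st'(5)[unfolded swap] by linarith
  then have "hessian f (x + s *\<^sub>R u + t *\<^sub>R v) u v = hessian f (x + s' *\<^sub>R v + t' *\<^sub>R u) v u"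
    using h by simp
  moreover have "dist (hessian f (x + s *\<^sub>R u + t *\<^sub>R v) u v) (hessian f x u v) < e"
    using near[OF st(1-4), of u v] by (intro d1) simp
  moreover have "dist (hessian f (x + s' *\<^sub>R v + t' *\<^sub>R u) v u) (hessian f x v u) < e"
    using near[OF st'(1-4), of v u] by (intro d2) simp
  ultimately have "dist (hessian f x u v) (hessian f x v u) < dist (hessian f x u v) (hessian f x v u)"
    unfolding e_def by (metis dist_triangle_half_r)
  then show False by simp
qed

section \<open>One-sided minima and the second-order Lagrange condition\<close>

lemma second_order_increase:
  fixes g g' :: "real \<Rightarrow> real"
  assumes g: "\<And>t. (g has_real_derivative g' t) (at t)" and g0: "g' 0 = 0"
    and c: "(g' has_real_derivative c) (at 0)" "c > 0"
  shows "\<forall>\<^sub>F t in at_right 0. g 0 < g t"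
proof -
  obtain d where d: "d > 0" "\<And>h. 0 < h \<Longrightarrow> h < d \<Longrightarrow> g' 0 < g' (0 + h)"
    using DERIV_pos_inc_right[OF c] by blast
  have "g 0 < g t" if t: "0 < t" "t < d" for t
  proof -
    obtain s where "0 < s" "s < t" "g t - g 0 = (t - 0) * g' s"
      using MVT2[OF t(1) g] by blast
    moreover have "g' s > 0" using d(2)[of s] calculation t g0 by simp
    ultimately show ?thesis using t by (metis diff_gt_0_iff_gt diff_zero mult_pos_pos)
  qed
  then show ?thesis using d(1) by (auto simp: eventually_at_right)
qed

lemma first_order_increase:
  fixes g :: "real \<Rightarrow> real"
  assumes "(g has_real_derivative c) (at 0)" "c > 0"
  shows "\<forall>\<^sub>F t in at_right 0. g 0 < g t"
  using DERIV_pos_inc_right[OF assms] by (auto simp: eventually_at_right)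

text \<open>One-sided, because the test curves below are known to be admissible only for
  \<open>t > 0\<close>. With a wrong sign, \<open>- g\<close> would strictly increase to the right
  of 0.\<close>

lemma right_minimum_conditions:
  fixes g g' :: "real \<Rightarrow> real"
  assumes g: "\<And>t. (g has_real_derivative g' t) (at t)" and c: "(g' has_real_derivative c) (at 0)"
    and min: "\<forall>\<^sub>F t in at_right 0. g 0 \<le> g t"
  shows "g' 0 \<ge> 0" and "g' 0 = 0 \<Longrightarrow> c \<ge> 0"
proof -
  have no: False if "\<forall>\<^sub>F t in at_right 0. - g 0 < - g t"
    using eventually_happens[OF eventually_conj[OF min that]] by auto
  show "g' 0 \<ge> 0"
    using no first_order_increase[OF DERIV_minus[OF g]] by (metis neg_0_less_iff_less not_le)
  show "c \<ge> 0" if "g' 0 = 0"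
    using no second_order_increase[OF DERIV_minus[OF g] _ DERIV_minus[OF c]] that
    by (metis neg_0_less_iff_less not_le neg_equal_0_iff_equal)
qed

text \<open>The quadratic coefficient \<open>w\<close> enters the second derivative along the curve
  through the first derivative of the function. A curve tangent to a level set of \<open>r\<close>
  can thus be bent into the region \<open>r > 0\<close>.\<close>

definition parabola :: "'a::euclidean_space \<Rightarrow> 'a \<Rightarrow> 'a \<Rightarrow> real \<Rightarrow> 'a" where
  "parabola z v w t = z + t *\<^sub>R v + t\<^sup>2 *\<^sub>R w"

lemma parabola_0 [simp]: "parabola z v w 0 = z"
  by (simp add: parabola_def)

lemma parabola_derivative:
  "(parabola z v w has_derivative (\<lambda>h. h *\<^sub>R (v + (2 * t) *\<^sub>R w))) (at t)"
  unfolding parabola_def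
  by (auto intro!: derivative_eq_intros simp: algebra_simps)

lemma smooth_parabola_derivative:
  assumes "smooth f"
  shows "((\<lambda>t. f (parabola z v w t)) has_real_derivative
    frechet_derivative f (at (parabola z v w t)) (v + (2 * t) *\<^sub>R w)) (at t)"
  by (rule has_derivative_imp_has_field_derivative[OF
        has_derivative_compose[OF parabola_derivative smooth_has_derivative[OF assms]]])
     (simp add: linear_scale[OF smooth_linear_derivative[OF assms]])

lemma smooth_parabola_second_derivative:
  assumes f: "smooth f"
  shows "((\<lambda>t. frechet_derivative f (at (parabola z v w t)) (v + (2 * t) *\<^sub>R w)) has_real_derivative
    hessian f z v v + 2 * frechet_derivative f (at z) w) (at 0)"
proof -
  let ?d = "\<lambda>u t. frechet_derivative f (at (parabola z v w t)) u"
  have eq: "?d (v + (2 * t) *\<^sub>R w) t = ?d v t + 2 * t * ?d w t" for t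
    using linear_add[OF smooth_linear_derivative[OF f]] linear_scale[OF smooth_linear_derivative[OF f]]
    by simp
  have D: "(?d u has_real_derivative hessian f z u v) (at 0)" for u
    using smooth_parabola_derivative[OF smooth_derivative[OF f], of z v w u 0]
    by (simp add: hessian_def)
  show ?thesis
    unfolding eq
    by (rule DERIV_cong[OF DERIV_add[OF D DERIV_mult[OF DERIV_cmult[OF DERIV_ident] D]]]) simp
qed

text \<open>The constraint \<open>r \<ge> 0\<close> is tested on parabolas. The one along
  \<open>\<nu>\<close> gives the sign of the multiplier; tangential ones, bent into the admissible
  region, show first that the gradients are parallel and then, bent as little as possible, compare
  the Hessians.\<close>

lemma second_order_lagrange:
  fixes f r :: "'a::euclidean_space \<Rightarrow> real"
  assumes f: "smooth f" and r: "smooth r" and rz: "r z = 0" and nz: "gradient r z \<noteq> 0"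
    and min: "\<forall>\<^sub>F x in nhds z. r x \<ge> 0 \<longrightarrow> f z \<le> f x"
  obtains l where "l \<ge> 0" "gradient f z = l *\<^sub>R gradient r z"
    "\<And>v. v \<bullet> gradient r z = 0 \<Longrightarrow> l * hessian r z v v \<le> hessian f z v v"
proof -
  define \<nu> where "\<nu> = gradient r z"
  define a where "a = \<nu> \<bullet> gradient f z"
  define b where "b = \<nu> \<bullet> \<nu>"
  have b: "b > 0" using nz by (simp add: b_def \<nu>_def)
  have curve: "\<forall>\<^sub>F t in at_right 0. f (parabola z v w 0) \<le> f (parabola z v w t)"
    if "\<forall>\<^sub>F t in at_right 0. r (parabola z v w 0) < r (parabola z v w t)" for v w
  proof -
    have "isCont (parabola z v w) 0" using parabola_derivative has_derivative_continuous by blast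
    then have "(parabola z v w \<longlongrightarrow> z) (at_right 0)"
      using tendsto_mono[OF at_le[OF subset_UNIV]] by (fastforce simp: isCont_def)
    from eventually_compose_filterlim[OF min this] that show ?thesis
      by eventually_elim (use rz in auto)
  qed
  note fc = right_minimum_conditions[OF smooth_parabola_derivative[OF f]
      smooth_parabola_second_derivative[OF f] curve]
  have "a \<ge> 0"
  proof -
    have "\<forall>\<^sub>F t in at_right 0. r (parabola z \<nu> 0 0) < r (parabola z \<nu> 0 t)"
      by (rule first_order_increase[OF smooth_parabola_derivative[OF r]])
         (use b in \<open>simp add: smooth_derivative_gradient[OF r] b_def \<nu>_def\<close>)
    from fc(1)[OF this] show ?thesis by (simp add: smooth_derivative_gradient[OF f] a_def)
  qed
  \<comment> \<open>Along the parabola with quadratic coefficient \<open>s *\<^sub>R \<nu>\<close>,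
    the function \<open>r\<close> has first derivative 0 and positive second derivative at 0, so the
    curve is admissible for small \<open>t > 0\<close>.\<close>
  have tangent: "v \<bullet> gradient f z \<ge> 0" "v \<bullet> gradient f z = 0 \<Longrightarrow> 0 \<le> hessian f z v v + 2 * s * a"
    if v: "v \<bullet> \<nu> = 0" and s: "hessian r z v v + 2 * s * b > 0" for v s
  proof -
    have "\<forall>\<^sub>F t in at_right 0. r (parabola z v (s *\<^sub>R \<nu>) 0) < r (parabola z v (s *\<^sub>R \<nu>) t)"
      by (rule second_order_increase[OF smooth_parabola_derivative[OF r] _
            smooth_parabola_second_derivative[OF r]])
         (use v s in \<open>simp_all add: smooth_derivative_gradient[OF r] b_def flip: \<nu>_def\<close>)
    from fc[OF this] show "v \<bullet> gradient f z \<ge> 0"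
      "v \<bullet> gradient f z = 0 \<Longrightarrow> 0 \<le> hessian f z v v + 2 * s * a"
      by (simp_all add: smooth_derivative_gradient[OF f] a_def)
  qed
  have ker: "v \<bullet> gradient f z = 0" if v: "v \<bullet> \<nu> = 0" for v
  proof -
    \<comment> \<open>These bendings make the second derivative of \<open>r\<close> equal to 1 along
      the curves for \<open>v\<close> and \<open>-v\<close>; the two resulting signs force
      equality.\<close>
    have "hessian r z v v + 2 * ((1 - hessian r z v v) / (2 * b)) * b > 0"
      "hessian r z (-v) (-v) + 2 * ((1 - hessian r z (-v) (-v)) / (2 * b)) * b > 0"
      using b by (simp_all add: field_simps)
    from tangent(1)[OF v this(1)] tangent(1)[OF _ this(2)] v show ?thesis by simp
  qed
  define l where "l = a / b"
  show ?thesis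
  proof
    show "l \<ge> 0" using \<open>a \<ge> 0\<close> b by (simp add: l_def)
    show "gradient f z = l *\<^sub>R gradient r z"
    proof -
      let ?w = "gradient f z - l *\<^sub>R \<nu>"
      have "?w \<bullet> \<nu> = 0" using b 
        by (simp add: inner_diff_left inner_diff_right l_def a_def b_def inner_commute)
      then have "?w \<bullet> ?w = 0" using ker[of ?w] by (simp add: inner_diff_right)
      then show ?thesis by (simp add: \<nu>_def)
    qed
    show "l * hessian r z v v \<le> hessian f z v v" if "v \<bullet> gradient r z = 0" for v
    proof (rule field_le_epsilon)
      fix e :: real assume e: "e > 0"
      \<comment> \<open>The bending \<open>d - hessian r z v v / (2 * b)\<close> leaves
        \<open>r\<close> the second derivative \<open>2 * d * b\<close>, which is barely positive,
        while \<open>d\<close> costs at most \<open>e\<close> on the side of \<open>f\<close>. The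
        summand 1 allows for \<open>a = 0\<close>.\<close>
      define d where "d = e / (2 * a + 1)"
      have d: "d > 0" "2 * a * d \<le> e" using e \<open>a \<ge> 0\<close> by (simp_all add: d_def field_simps)
      have v: "v \<bullet> \<nu> = 0" using that by (simp add: \<nu>_def)
      have "hessian r z v v + 2 * (d - hessian r z v v / (2 * b)) * b > 0"
        using b d by (simp add: field_simps)
      from tangent(2)[OF v this ker[OF v]]
      have "0 \<le> hessian f z v v + 2 * (d - hessian r z v v / (2 * b)) * a" .
      also have "2 * (d - hessian r z v v / (2 * b)) * a = 2 * a * d - l * hessian r z v v"
        using b by (simp add: l_def field_simps)
      finally show "l * hessian r z v v \<le> hessian f z v v + e" using d(2) by linarith
    qed
  qed
qed

section \<open>The Levi form in terms of real derivatives\<close>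

lemma complex_vector_expansion:
  "(\<xi> :: complex^'n) = (\<Sum>i\<in>UNIV. Re (\<xi> $ i) *\<^sub>R axis i 1 + Im (\<xi> $ i) *\<^sub>R axis i \<i>)"
proof -
  have "(\<Sum>i\<in>UNIV. Re (\<xi> $ i) *\<^sub>R axis i 1 + Im (\<xi> $ i) *\<^sub>R axis i \<i>) $ k = \<xi> $ k" for k
  proof -
    have "(\<Sum>i\<in>UNIV. Re (\<xi> $ i) *\<^sub>R axis i 1 + Im (\<xi> $ i) *\<^sub>R axis i \<i>) $ k
        = (\<Sum>i\<in>UNIV. if i = k then \<xi> $ i else 0)"
      unfolding sum_component by (rule sum.cong) (auto simp: axis_def complex_eq_iff)
    then show ?thesis by simp
  qed
  then show ?thesis by (simp add: vec_eq_iff)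
qed

lemma linear_complex_vector:
  fixes F :: "complex^'n \<Rightarrow> real"
  assumes "linear F"
  shows "F \<xi> = (\<Sum>i\<in>UNIV. Re (\<xi> $ i) * F (axis i 1) + Im (\<xi> $ i) * F (axis i \<i>))"
  by (subst complex_vector_expansion)
     (simp add: linear_sum[OF assms] linear_add[OF assms] linear_scale[OF assms])

lemma wirtinger_of_real:
  assumes "smooth f"
  shows "wirtinger i (\<lambda>z. complex_of_real (f z)) p =
      (complex_of_real (frechet_derivative f (at p) (axis i 1))
       - \<i> * complex_of_real (frechet_derivative f (at p) (axis i \<i>))) / 2"
    and "wirtinger_bar i (\<lambda>z. complex_of_real (f z)) p =
      (complex_of_real (frechet_derivative f (at p) (axis i 1))
       + \<i> * complex_of_real (frechet_derivative f (at p) (axis i \<i>))) / 2"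
proof -
  have "frechet_derivative (\<lambda>z. complex_of_real (f z)) (at p)
      = (\<lambda>v. complex_of_real (frechet_derivative f (at p) v))"
    by (rule frechet_derivative_at[symmetric])
       (rule has_derivative_of_real[OF smooth_has_derivative[OF assms]])
  then show "wirtinger i (\<lambda>z. complex_of_real (f z)) p =
      (complex_of_real (frechet_derivative f (at p) (axis i 1))
       - \<i> * complex_of_real (frechet_derivative f (at p) (axis i \<i>))) / 2"
    and "wirtinger_bar i (\<lambda>z. complex_of_real (f z)) p =
      (complex_of_real (frechet_derivative f (at p) (axis i 1))
       + \<i> * complex_of_real (frechet_derivative f (at p) (axis i \<i>))) / 2"
    by (simp_all add: wirtinger_def wirtinger_bar_def)
qed

lemma wirtinger_wirtinger_bar:
  assumes f: "smooth f"
  shows "wirtinger i (wirtinger_bar j (\<lambda>z. complex_of_real (f z))) p =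
    Complex (hessian f p (axis j 1) (axis i 1) + hessian f p (axis j \<i>) (axis i \<i>))
      (hessian f p (axis j \<i>) (axis i 1) - hessian f p (axis j 1) (axis i \<i>)) / 4"
proof -
  have "(wirtinger_bar j (\<lambda>z. complex_of_real (f z)) has_derivative
      (\<lambda>v. (complex_of_real (hessian f p (axis j 1) v) + \<i> * complex_of_real (hessian f p (axis j \<i>) v)) / 2)) (at p)"
    unfolding wirtinger_of_real(2)[OF f, abs_def]
    by (intro bounded_linear.has_derivative[OF bounded_linear_divide] has_derivative_add has_derivative_mult_right has_derivative_of_real
        hessian_has_derivative f)
  from frechet_derivative_at[OF this, symmetric] show ?thesis
    by (simp add: wirtinger_def complex_eq_iff)
qed

text \<open>Twice the Wirtinger derivative of a real function is the conjugate of the corresponding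
  component of its gradient, read as a complex vector.\<close>

lemma complex_tangent_space_gradient:
  assumes f: "smooth f"
  shows "complex_tangent_space f p = {\<xi>. hermitian_inner \<xi> (gradient f p) = 0}"
proof -
  note df = smooth_derivative_gradient[OF f]
  have "2 * (\<Sum>i\<in>UNIV. wirtinger i (\<lambda>z. complex_of_real (f z)) p * \<xi> $ i)
      = hermitian_inner \<xi> (gradient f p)" for \<xi>
  proof -
    have comp: "axis i 1 \<bullet> gradient f p = Re (gradient f p $ i)"
         "axis i \<i> \<bullet> gradient f p = Im (gradient f p $ i)" for i
      by (simp_all add: inner_axis' inner_complex_def)
    show ?thesis
      unfolding hermitian_inner_def sum_distrib_left
      by (rule sum.cong) (simp_all add: wirtinger_of_real[OF f] df comp complex_eq_iff)
  qed
  then show ?thesis unfolding complex_tangent_space_def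
    by (metis (no_types, lifting) mult_eq_0_iff zero_neq_numeral)
qed

lemma levi_form_hermitian:
  assumes f: "smooth f"
  shows "hermitian_form (levi_form f p) (complex_tangent_space f p)"
proof
  show "levi_form f p (x + y) z = levi_form f p x z + levi_form f p y z" for x y z
    by (simp add: levi_form_def algebra_simps sum.distrib)
  show "levi_form f p (c *s x) z = c * levi_form f p x z" for c x z
    by (simp add: levi_form_def sum_distrib_left mult_ac)
  show "cnj (levi_form f p x y) = levi_form f p y x" for x y
  proof -
    \<comment> \<open>The coefficient matrix is Hermitian because the real Hessian is
      symmetric.\<close>
    have "cnj (wirtinger i (wirtinger_bar j (\<lambda>z. complex_of_real (f z))) p)
        = wirtinger j (wirtinger_bar i (\<lambda>z. complex_of_real (f z))) p" for i j
      unfolding wirtinger_wirtinger_bar[OF f]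
      using hessian_symmetric[OF f, of p] by (simp add: complex_eq_iff)
    then show ?thesis
      unfolding levi_form_def
      by (subst sum.swap) (simp add: cnj_sum mult_ac)
  qed
  show "vec.subspace (complex_tangent_space f p)"
    unfolding complex_tangent_space_gradient[OF f] vec.subspace_def
    by (simp add: hermitian_inner_add_left hermitian_inner_scale_left hermitian_inner.zero_left)
qed

text \<open>Averaging the Hessian over \<open>\<xi>\<close> and \<open>\<i> *s \<xi>\<close> cancels
  its complex-bilinear part. This is the bridge from the real second-order condition to the Levi
  form: multiplication by \<open>\<i>\<close> preserves the complex tangent space.\<close>

lemma levi_form_hessian:
  assumes f: "smooth f"
  shows "Re (levi_form f p \<xi> \<xi>) = (hessian f p \<xi> \<xi> + hessian f p (\<i> *s \<xi>) (\<i> *s \<xi>)) / 4"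
proof -
  let ?H = "hessian f p"
  have expand: "?H u v = (\<Sum>i\<in>UNIV. \<Sum>j\<in>UNIV.
      Re (u $ i) * Re (v $ j) * ?H (axis i 1) (axis j 1) + Re (u $ i) * Im (v $ j) * ?H (axis i 1) (axis j \<i>)
      + Im (u $ i) * Re (v $ j) * ?H (axis i \<i>) (axis j 1) + Im (u $ i) * Im (v $ j) * ?H (axis i \<i>) (axis j \<i>))"
    for u v
  proof -
    have right: "?H w v = (\<Sum>j\<in>UNIV. Re (v $ j) * ?H w (axis j 1) + Im (v $ j) * ?H w (axis j \<i>))" for w
      by (rule linear_complex_vector[OF linear_hessian_right[OF f]])
    have "?H u v = (\<Sum>i\<in>UNIV. Re (u $ i) * ?H (axis i 1) v + Im (u $ i) * ?H (axis i \<i>) v)"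
      by (rule linear_complex_vector[OF linear_hessian_left[OF f]])
    also have "\<dots> = (\<Sum>i\<in>UNIV. \<Sum>j\<in>UNIV.
      Re (u $ i) * Re (v $ j) * ?H (axis i 1) (axis j 1) + Re (u $ i) * Im (v $ j) * ?H (axis i 1) (axis j \<i>)
      + Im (u $ i) * Re (v $ j) * ?H (axis i \<i>) (axis j 1) + Im (u $ i) * Im (v $ j) * ?H (axis i \<i>) (axis j \<i>))"
      by (rule sum.cong[OF refl], subst (1 2) right)
         (simp add: sum_distrib_left distrib_left add.assoc mult.assoc flip: sum.distrib)
    finally show ?thesis .
  qed
  have "4 * Re (levi_form f p \<xi> \<xi>) = ?H \<xi> \<xi> + ?H (\<i> *s \<xi>) (\<i> *s \<xi>)"
    unfolding expand[of \<xi> \<xi>] expand[of "\<i> *s \<xi>" "\<i> *s \<xi>"] levi_form_def Re_sum sum_distrib_left sum.distrib[symmetric]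
  proof (intro sum.cong refl)
    fix i j
    have sym: "?H (axis j 1) (axis i 1) = ?H (axis i 1) (axis j 1)"
      "?H (axis j \<i>) (axis i 1) = ?H (axis i 1) (axis j \<i>)"
      "?H (axis j 1) (axis i \<i>) = ?H (axis i \<i>) (axis j 1)"
      "?H (axis j \<i>) (axis i \<i>) = ?H (axis i \<i>) (axis j \<i>)"
      by (rule hessian_symmetric[OF f])+
    show "4 * Re (wirtinger i (wirtinger_bar j (\<lambda>z. complex_of_real (f z))) p * \<xi> $ i * cnj (\<xi> $ j)) =
      Re (\<xi> $ i) * Re (\<xi> $ j) * ?H (axis i 1) (axis j 1) + Re (\<xi> $ i) * Im (\<xi> $ j) * ?H (axis i 1) (axis j \<i>)
      + Im (\<xi> $ i) * Re (\<xi> $ j) * ?H (axis i \<i>) (axis j 1) + Im (\<xi> $ i) * Im (\<xi> $ j) * ?H (axis i \<i>) (axis j \<i>) +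
      (Re ((\<i> *s \<xi>) $ i) * Re ((\<i> *s \<xi>) $ j) * ?H (axis i 1) (axis j 1) + Re ((\<i> *s \<xi>) $ i) * Im ((\<i> *s \<xi>) $ j) * ?H (axis i 1) (axis j \<i>)
      + Im ((\<i> *s \<xi>) $ i) * Re ((\<i> *s \<xi>) $ j) * ?H (axis i \<i>) (axis j 1) + Im ((\<i> *s \<xi>) $ i) * Im ((\<i> *s \<xi>) $ j) * ?H (axis i \<i>) (axis j \<i>))"
      unfolding wirtinger_wirtinger_bar[OF f] sym by (simp add: field_simps)
  qed
  then show ?thesis by simp
qed

lemma tendsto_levi_form:
  assumes f: "smooth f" and z: "(z \<longlongrightarrow> p) F" and x: "(x \<longlongrightarrow> \<xi>) F" and y: "(y \<longlongrightarrow> \<eta>) F"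
  shows "((\<lambda>k. levi_form f (z k) (x k) (y k)) \<longlongrightarrow> levi_form f p \<xi> \<eta>) F"
proof -
  have H: "((\<lambda>k. hessian f (z k) u v) \<longlongrightarrow> hessian f p u v) F" for u v
    using continuous_on_tendsto_compose[OF continuous_hessian[OF f] z] by simp
  have A: "((\<lambda>k. wirtinger i (wirtinger_bar j (\<lambda>z. complex_of_real (f z))) (z k))
      \<longlongrightarrow> wirtinger i (wirtinger_bar j (\<lambda>z. complex_of_real (f z))) p) F" for i j
    unfolding wirtinger_wirtinger_bar[OF f]
    by (intro tendsto_divide tendsto_Complex tendsto_add tendsto_diff H tendsto_const) simp
  show ?thesis
    unfolding levi_form_def by (intro tendsto_sum tendsto_mult tendsto_cnj tendsto_vec_nth A x y)
qed

section \<open>Touching from inside\<close>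

lemma continuous_hermitian_inner: "continuous_on UNIV (\<lambda>x. hermitian_inner x y)"
  unfolding hermitian_inner_def by (intro continuous_intros)

lemma levi_trace_iff:
  assumes f: "smooth f"
  shows "(\<forall>M. size M = q \<and> (\<forall>\<mu>. count M \<mu> \<le> vec.dim (levi_eigenspace f p \<mu>)) \<longrightarrow> 0 \<le> sum_mset M) \<longleftrightarrow>
    (\<forall>F. finite F \<and> card F = q \<and> F \<subseteq> complex_tangent_space f p \<and> orthonormal F \<longrightarrow>
       0 \<le> (\<Sum>v\<in>F. Re (levi_form f p v v)))"
proof -
  interpret hermitian_form "levi_form f p" "complex_tangent_space f p"
    using f by (rule levi_form_hermitian)
  have "levi_eigenspace f p = eigenspace"
    by (simp add: fun_eq_iff levi_eigenspace_def eigenspace_def)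
  moreover have "closed (complex_tangent_space f p)"
    unfolding complex_tangent_space_gradient[OF f]
    by (intro closed_Collect_eq continuous_hermitian_inner continuous_on_const)
  moreover have "continuous_on UNIV (\<lambda>x. Re (levi_form f p x x))"
    unfolding levi_form_def by (intro continuous_intros)
  ultimately show ?thesis using eigenvalue_sums_nonneg_iff by simp
qed

section \<open>Transporting orthonormal frames between tangent spaces\<close>

lemma scaleR_eq_cscale: "c *\<^sub>R (x :: complex^'n) = complex_of_real c *s x"
  unfolding vec_eq_iff vector_scaleR_component vector_smult_component
  by (simp add: scaleR_conv_of_real)

lemma hermitian_inner_scaleR_right: "hermitian_inner x (c *\<^sub>R y) = complex_of_real c * hermitian_inner x y"
  by (simp add: scaleR_eq_cscale hermitian_inner.scale_right)

text \<open>For unit vectors \<open>a\<close> and \<open>b\<close> this restricts to an isometry from the orthogonal complement of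
  \<open>a\<close> to that of \<open>b\<close>: it is the complex Householder reflection sending \<open>a\<close> to \<open>-b\<close>, chosen
  because it tends to the identity on the complement of \<open>a\<close> as \<open>b\<close> tends to \<open>a\<close>.\<close>

definition transport :: "complex^'n \<Rightarrow> complex^'n \<Rightarrow> complex^'n \<Rightarrow> complex^'n" where
  "transport a b x = x - (hermitian_inner x b / (1 + hermitian_inner a b)) *s (a + b)"

lemma hermitian_inner_diff_left: "hermitian_inner (x - y) z = hermitian_inner x z - hermitian_inner y z"
  using hermitian_inner_add_left[of "x - y" y z] by simp

lemma hermitian_inner_diff_right: "hermitian_inner z (x - y) = hermitian_inner z x - hermitian_inner z y"
  using hermitian_inner.add_right[of z "x - y" y] by simp

lemma transport_orthogonal:
  assumes "hermitian_inner b b = 1" "1 + hermitian_inner a b \<noteq> 0"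
  shows "hermitian_inner (transport a b x) b = 0"
  unfolding transport_def hermitian_inner_diff_left hermitian_inner_scale_left
    hermitian_inner_add_left assms(1)
  using assms(2) by (simp add: add.commute)

text \<open>The image of \<open>x\<close> is orthogonal to \<open>b\<close>, so the correction of
  \<open>y\<close> is seen only through its multiple of \<open>a\<close>; this cancels the
  correction of \<open>x\<close> against \<open>y\<close>.\<close>

lemma transport_isometry:
  assumes a: "hermitian_inner a a = 1" and b: "hermitian_inner b b = 1"
    and s: "1 + hermitian_inner a b \<noteq> 0"
    and x: "hermitian_inner x a = 0" and y: "hermitian_inner y a = 0"
  shows "hermitian_inner (transport a b x) (transport a b y) = hermitian_inner x y"
proof -
  define t where "t = hermitian_inner a b"
  define c where "c = hermitian_inner x b / (1 + t)"
  have ay: "hermitian_inner a y = 0" using hermitian_inner_commute[of y a] y by simp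
  have orth: "hermitian_inner (transport a b x) b = 0"
    using transport_orthogonal b s .
  have "hermitian_inner (transport a b x) (transport a b y)
      = hermitian_inner (transport a b x) y
        - cnj (hermitian_inner y b / (1 + t)) * hermitian_inner (transport a b x) a"
    unfolding transport_def[of a b y] t_def hermitian_inner_diff_right hermitian_inner.scale_right
      hermitian_inner.add_right orth by simp
  also have "hermitian_inner (transport a b x) a = - c * (1 + cnj t)"
    unfolding transport_def hermitian_inner_diff_left hermitian_inner_scale_left
      hermitian_inner_add_left x a c_def t_def hermitian_inner_commute by simp
  also have "hermitian_inner (transport a b x) y = hermitian_inner x y - c * cnj (hermitian_inner y b)"
    unfolding transport_def hermitian_inner_diff_left hermitian_inner_scale_left
      hermitian_inner_add_left c_def t_def hermitian_inner_commute by (simp add: ay)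
  also have "cnj (hermitian_inner y b / (1 + t)) * (- c * (1 + cnj t)) = - c * cnj (hermitian_inner y b)"
  proof -
    have "1 + cnj t \<noteq> 0"
      using s unfolding t_def[symmetric] by (metis complex_cnj_add complex_cnj_one complex_cnj_zero_iff)
    then show ?thesis by simp
  qed
  finally show ?thesis by simp
qed

lemma transport_orthonormal:
  assumes a: "hermitian_inner a a = 1" and b: "hermitian_inner b b = 1"
    and s: "1 + hermitian_inner a b \<noteq> 0"
    and F: "orthonormal F" "\<And>v. v \<in> F \<Longrightarrow> hermitian_inner v a = 0"
  shows "orthonormal (transport a b ` F)" "inj_on (transport a b) F"
proof -
  have iso: "hermitian_inner (transport a b v) (transport a b w) = (if v = w then 1 else 0)"
    if "v \<in> F" "w \<in> F" for v w
    using transport_isometry[OF a b s F(2)[OF that(1)] F(2)[OF that(2)]] F(1) that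
    by (simp add: orthonormal_def)
  then show "inj_on (transport a b) F"
    by (intro inj_onI) (metis zero_neq_one)
  with iso show "orthonormal (transport a b ` F)"
    by (auto simp: orthonormal_def inj_on_eq_iff)
qed

lemma tendsto_hermitian_inner:
  "(x \<longlongrightarrow> \<xi>) F \<Longrightarrow> (y \<longlongrightarrow> \<eta>) F \<Longrightarrow> ((\<lambda>k. hermitian_inner (x k) (y k)) \<longlongrightarrow> hermitian_inner \<xi> \<eta>) F"
  unfolding hermitian_inner_def by (intro tendsto_sum tendsto_mult tendsto_cnj tendsto_vec_nth)

lemma tendsto_transport:
  assumes b: "(b \<longlongrightarrow> a) F" and a: "hermitian_inner a a = 1" and x: "hermitian_inner x a = 0"
  shows "((\<lambda>k. transport a (b k) x) \<longlongrightarrow> x) F"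
proof -
  have "((\<lambda>k. hermitian_inner x (b k) / (1 + hermitian_inner a (b k))) \<longlongrightarrow> 0 / (1 + 1)) F"
    using tendsto_hermitian_inner[OF tendsto_const b, of x]
      tendsto_hermitian_inner[OF tendsto_const b, of a] x a
    by (intro tendsto_divide tendsto_add tendsto_const) auto
  then have c: "((\<lambda>k. hermitian_inner x (b k) / (1 + hermitian_inner a (b k))) \<longlongrightarrow> 0) F" by simp
  have "((\<lambda>k. transport a (b k) x $ i) \<longlongrightarrow> x $ i - 0 * (a $ i + a $ i)) F" for i
    unfolding transport_def vector_minus_component vector_smult_component vector_add_component
    by (intro tendsto_diff tendsto_mult tendsto_add c tendsto_const tendsto_vec_nth b)
  then show ?thesis by (intro vec_tendstoI) simp
qed

section \<open>Comparison at a touching point and the penalty\<close>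

lemma defining_function_gradient:
  assumes "normalized_defining_function \<Omega> r" "p \<in> frontier \<Omega>"
  shows "gradient r p \<noteq> 0"
proof -
  have "smooth r" and "\<exists>d. GDERIV r p :> d \<and> d \<noteq> 0"
    using assms unfolding normalized_defining_function_def defining_function_def by blast+
  then show ?thesis using gderiv_unique smooth_gderiv by metis
qed

text \<open>The complement of \<open>\<Omega>\<close> is \<open>r \<ge> 0\<close>, so the Lagrange
  condition applies. Its multiplier is nonzero as \<open>gradient f z\<close> is, hence
  \<open>f\<close> and \<open>r\<close> have the same complex tangent vectors at \<open>z\<close>.
  Adding the Hessian inequalities for \<open>v\<close> and \<open>\<i> *s v\<close> compares the
  Levi forms.\<close>

lemma touching_trace_nonneg:
  fixes f :: "complex^'n \<Rightarrow> real"
  assumes \<Omega>: "hyper_q_convex q \<Omega>" and f: "smooth f" and U: "open U" and z: "z \<in> U" "z \<notin> \<Omega>"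
    and min: "\<And>x. x \<in> U \<Longrightarrow> x \<notin> \<Omega> \<Longrightarrow> f z \<le> f x" and nz: "gradient f z \<noteq> 0"
    and G: "finite G" "card G = q" "orthonormal G" "\<And>v. v \<in> G \<Longrightarrow> hermitian_inner v (gradient f z) = 0"
  shows "0 \<le> (\<Sum>v\<in>G. Re (levi_form f z v v))"
proof -
  obtain r where r: "normalized_defining_function \<Omega> r"
    and eig: "\<forall>p\<in>frontier \<Omega>. \<forall>M :: real multiset. size M = q \<and>
      (\<forall>\<mu>. count M \<mu> \<le> vec.dim (levi_eigenspace r p \<mu>)) \<longrightarrow> 0 \<le> sum_mset M"
    using \<Omega> unfolding hyper_q_convex_def by blast
  have smooth: "smooth r" and \<Omega>_eq: "\<Omega> = {z. r z < 0}"
    using r unfolding normalized_defining_function_def defining_function_def by auto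
  \<comment> \<open>Outside the closure the minimum would be unconstrained near \<open>z\<close>,
    and the gradient of \<open>f\<close> would vanish.\<close>
  have "z \<in> closure \<Omega>"
  proof (rule ccontr)
    assume "z \<notin> closure \<Omega>"
    define V where "V = U - closure \<Omega>"
    have V: "open V" "z \<in> V" using U z \<open>z \<notin> closure \<Omega>\<close> by (auto simp: V_def)
    have "\<forall>y\<in>V. f z \<le> f y" using min closure_subset by (fastforce simp: V_def)
    with differential_zero_maxmin[OF V(2,1) smooth_has_derivative[OF f]]
    have "frechet_derivative f (at z) = (\<lambda>v. 0)" by blast
    then show False using nz by (simp add: gradient_def)
  qed
  then have fr: "z \<in> frontier \<Omega>"
    using z(2) interior_subset by (auto simp: frontier_def)
  have rz: "r z = 0" using frontier_sublevel[OF smooth] fr \<Omega>_eq by blast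
  have rnz: "gradient r z \<noteq> 0" using r fr by (rule defining_function_gradient)
  have "\<forall>\<^sub>F x in nhds z. x \<in> U" using U z(1) by (rule eventually_nhds_in_open)
  then have "\<forall>\<^sub>F x in nhds z. r x \<ge> 0 \<longrightarrow> f z \<le> f x"
  proof eventually_elim
    case (elim x)
    then show ?case using min[of x] unfolding \<Omega>_eq by simp
  qed
  from second_order_lagrange[OF f smooth rz rnz this]
  obtain l where l: "l \<ge> 0" "gradient f z = l *\<^sub>R gradient r z"
    "\<And>v. v \<bullet> gradient r z = 0 \<Longrightarrow> l * hessian r z v v \<le> hessian f z v v"
    by blast
  have "l \<noteq> 0" using l(2) nz by auto
  have tangent: "hermitian_inner v (gradient r z) = 0" if "v \<in> G" for v
    using G(4)[OF that] \<open>l \<noteq> 0\<close> unfolding l(2) hermitian_inner_scaleR_right by simp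
  have le: "l * Re (levi_form r z v v) \<le> Re (levi_form f z v v)" if v: "v \<in> G" for v
  proof -
    have "v \<bullet> gradient r z = 0" "(\<i> *s v) \<bullet> gradient r z = 0"
      using tangent[OF v] by (simp_all add: hermitian_inner_scale_left flip: Re_hermitian_inner)
    from l(3)[OF this(1)] l(3)[OF this(2)] show ?thesis
      unfolding levi_form_hessian[OF f] levi_form_hessian[OF smooth] by (simp add: algebra_simps)
  qed
  have "G \<subseteq> complex_tangent_space r z"
    using tangent unfolding complex_tangent_space_gradient[OF smooth] by auto
  then have "0 \<le> (\<Sum>v\<in>G. Re (levi_form r z v v))"
    using eig[rule_format, OF fr] levi_trace_iff[OF smooth, of q z] G by blast
  then have "0 \<le> l * (\<Sum>v\<in>G. Re (levi_form r z v v))"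
    using l(1) by simp
  also have "\<dots> \<le> (\<Sum>v\<in>G. Re (levi_form f z v v))"
    unfolding sum_distrib_left by (rule sum_mono) (rule le)
  finally show ?thesis .
qed

text \<open>The penalty vanishes to first order at \<open>p\<close>, so the gradient and the complex
  tangent space there are unchanged, while the Levi form gains only \<open>e\<close> times the inner
  product.\<close>

definition penalized :: "('a::euclidean_space \<Rightarrow> real) \<Rightarrow> real \<Rightarrow> 'a \<Rightarrow> 'a \<Rightarrow> real" where
  "penalized f e p z = f z + e * ((z - p) \<bullet> (z - p))"

lemma smooth_penalized: "smooth f \<Longrightarrow> smooth (penalized f e p)"
  unfolding penalized_def[abs_def] by (intro smooth_add smooth_mult smooth_const smooth_dist_square)

lemma penalized_derivative:
  assumes "smooth f"
  shows "frechet_derivative (penalized f e p) (at x) u = frechet_derivative f (at x) u + 2 * e * ((x - p) \<bullet> u)"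
proof -
  have "(penalized f e p has_derivative
      (\<lambda>u. frechet_derivative f (at x) u + 2 * e * ((x - p) \<bullet> u))) (at x)"
    unfolding penalized_def[abs_def]
    by (rule derivative_eq_intros smooth_has_derivative[OF assms] refl)+
       (simp add: fun_eq_iff inner_commute algebra_simps)
  from frechet_derivative_at[OF this] show ?thesis by metis
qed

lemma penalized_gradient: "smooth f \<Longrightarrow> gradient (penalized f e p) p = gradient f p"
  by (simp add: gradient_def penalized_derivative)

lemma penalized_hessian:
  assumes "smooth f"
  shows "hessian (penalized f e p) x u v = hessian f x u v + 2 * e * (v \<bullet> u)"
proof -
  have "((\<lambda>y. frechet_derivative (penalized f e p) (at y) u) has_derivative
      (\<lambda>v. hessian f x u v + 2 * e * (v \<bullet> u))) (at x)"
    unfolding penalized_derivative[OF assms]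
    by (rule derivative_eq_intros hessian_has_derivative[OF assms] refl)+ simp
  from has_derivative_unique[OF hessian_has_derivative[OF smooth_penalized[OF assms]] this]
  show ?thesis by simp
qed

lemma penalized_levi_form:
  assumes "smooth f"
  shows "Re (levi_form (penalized f e p) x \<xi> \<xi>) = Re (levi_form f x \<xi> \<xi>) + e * (norm \<xi>)\<^sup>2"
proof -
  have "(\<i> *s \<xi>) \<bullet> (\<i> *s \<xi>) = \<xi> \<bullet> \<xi>"
    unfolding power2_norm_eq_inner[symmetric] norm_cscale by simp
  then show ?thesis
    unfolding levi_form_hessian[OF assms] levi_form_hessian[OF smooth_penalized[OF assms]]
      penalized_hessian[OF assms]
    by (simp add: power2_norm_eq_inner)
qed

section \<open>Convergence of the minimizers and passage to the limit\<close>

lemma compact_subset_increasing_union: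
  fixes A :: "nat \<Rightarrow> 'a::metric_space set"
  assumes K: "compact K" "K \<subseteq> (\<Union>j. A j)" and A: "\<And>j. open (A j)" "\<And>j. A j \<subseteq> A (Suc j)"
  shows "\<forall>\<^sub>F j in sequentially. K \<subseteq> A j"
proof -
  obtain I where I: "finite I" "K \<subseteq> (\<Union>j\<in>I. A j)"
    using compactE_image[OF K(1), of UNIV A] A(1) K(2) by auto
  obtain N where N: "\<And>i. i \<in> I \<Longrightarrow> i \<le> N"
    using I(1) unfolding finite_nat_set_iff_bounded_le by auto
  have mono: "A i \<subseteq> A j" if "i \<le> j" for i j
    using lift_Suc_mono_le[of A, OF A(2) that] .
  have "K \<subseteq> A j" if "j \<ge> N" for j
  proof
    fix x assume "x \<in> K"
    then obtain i where "i \<in> I" "x \<in> A i" using I(2) by auto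
    then show "x \<in> A j" using mono[of i j] N[of i] that by auto
  qed
  then show ?thesis unfolding eventually_sequentially by blast
qed

text \<open>The strict penalty makes \<open>p\<close> the only candidate limit of the minimizers.\<close>

lemma penalized_minimizers_converge:
  assumes f: "smooth f" and p: "f p = 0" "p \<notin> (\<Union>j. A j)" and e: "e > 0"
    and A: "\<And>j. open (A j)" "\<And>j. A j \<subseteq> A (Suc j)" "(\<Union>j. A j) = {z. f z < 0}"
  obtains z where "\<And>j. z j \<in> cball p 1 - A j"
    "\<And>j x. x \<in> cball p 1 - A j \<Longrightarrow> penalized f e p (z j) \<le> penalized f e p x"
    "z \<longlonglongrightarrow> p"
proof -
  let ?g = "penalized f e p"
  have cont: "continuous_on S ?g" for S
    using smooth_continuous[OF smooth_penalized[OF f]] continuous_on_subset by blast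
  have "\<exists>z. z \<in> cball p 1 - A j \<and> (\<forall>x\<in>cball p 1 - A j. ?g z \<le> ?g x)" for j
  proof -
    have "compact (cball p 1 - A j)" using A(1) by (intro compact_diff compact_cball)
    moreover have "p \<in> cball p 1 - A j" using p(2) by auto
    then have "cball p 1 - A j \<noteq> {}" by blast
    ultimately show ?thesis using continuous_attains_inf[OF _ _ cont] by blast
  qed
  then obtain z where z: "\<And>j. z j \<in> cball p 1 - A j"
    "\<And>j x. x \<in> cball p 1 - A j \<Longrightarrow> ?g (z j) \<le> ?g x"
    by metis
  moreover have "z \<longlonglongrightarrow> p"
  proof (rule tendstoI)
    fix d :: real assume d: "d > 0"
    \<comment> \<open>Comparison with \<open>p\<close> gives \<open>?g (z j) \<le> 0\<close>. The
      part of this sublevel set at distance at least \<open>d\<close> from \<open>p\<close> is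
      compact and lies in \<open>f < 0\<close>, so \<open>A j\<close> eventually swallows it,
      whereas \<open>z j\<close> is outside \<open>A j\<close>.\<close>
    define K where "K = (cball p 1 \<inter> {x. ?g x \<le> 0}) - ball p d"
    have "closed {x. ?g x \<le> 0}" by (intro closed_Collect_le cont continuous_on_const)
    then have "compact K" unfolding K_def
      by (intro compact_diff compact_Int_closed compact_cball open_ball)
    moreover have "K \<subseteq> (\<Union>j. A j)"
    proof
      fix x assume "x \<in> K"
      then have "?g x \<le> 0" "x \<noteq> p" using d by (auto simp: K_def)
      then have "e * ((x - p) \<bullet> (x - p)) > 0" using e by simp
      with \<open>?g x \<le> 0\<close> show "x \<in> (\<Union>j. A j)" unfolding A(3) penalized_def by simp
    qed
    ultimately have "\<forall>\<^sub>F j in sequentially. K \<subseteq> A j"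
      using compact_subset_increasing_union A(1,2) by metis
    then show "\<forall>\<^sub>F j in sequentially. dist (z j) p < d"
    proof eventually_elim
      case (elim j)
      have "p \<in> cball p 1 - A j" using p(2) by auto
      then have "?g (z j) \<le> 0" using z(2)[of p j] p(1) by (simp add: penalized_def)
      then show ?case using z(1)[of j] elim by (auto simp: K_def dist_commute)
    qed
  qed
  ultimately show ?thesis by (rule that)
qed

text \<open>The vectors of \<open>F\<close> are tangent at \<open>p\<close> but perhaps not at
  \<open>z j\<close>. Transport between the unit normals makes them orthonormal tangent vectors at
  \<open>z j\<close>, to which the hypothesis applies; they converge back to \<open>F\<close>, and
  their traces to the trace at \<open>p\<close>.\<close>

lemma tendsto_trace_nonneg:
  fixes f :: "complex^'n \<Rightarrow> real"
  assumes f: "smooth f" and z: "z \<longlonglongrightarrow> p" and nz: "gradient f p \<noteq> 0"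
    and F: "finite F" "card F = q" "orthonormal F" "\<And>v. v \<in> F \<Longrightarrow> hermitian_inner v (gradient f p) = 0"
    and nonneg: "\<forall>\<^sub>F j in sequentially. \<forall>G. finite G \<and> card G = q \<and> orthonormal G \<and>
        (\<forall>v\<in>G. hermitian_inner v (gradient f (z j)) = 0) \<longrightarrow> 0 \<le> (\<Sum>v\<in>G. Re (levi_form f (z j) v v))"
  shows "0 \<le> (\<Sum>v\<in>F. Re (levi_form f p v v))"
proof -
  define b where "b j = sgn (gradient f (z j))" for j
  define a where "a = sgn (gradient f p)"
  have unit: "hermitian_inner (sgn x) (sgn x) = 1" if "x \<noteq> 0" for x :: "complex^'n"
    using that by (simp add: hermitian_inner_self norm_sgn)
  have grad: "(\<lambda>j. gradient f (z j)) \<longlonglongrightarrow> gradient f p"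
    using continuous_on_tendsto_compose[OF continuous_gradient[OF f] z] by simp
  then have b: "b \<longlonglongrightarrow> a" unfolding b_def a_def using nz by (rule tendsto_sgn)
  have a: "hermitian_inner a a = 1" unfolding a_def using nz by (rule unit)
  have Fa: "hermitian_inner v a = 0" if "v \<in> F" for v
    using F(4)[OF that] by (simp add: a_def sgn_div_norm hermitian_inner_scaleR_right)
  have "(\<lambda>j. 1 + hermitian_inner a (b j)) \<longlonglongrightarrow> 1 + hermitian_inner a a"
    by (intro tendsto_intros tendsto_hermitian_inner b)
  then have "\<forall>\<^sub>F j in sequentially. 1 + hermitian_inner a (b j) \<noteq> 0"
    by (rule tendsto_imp_eventually_ne) (simp add: a)
  moreover have "\<forall>\<^sub>F j in sequentially. gradient f (z j) \<noteq> 0"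
    using grad nz by (rule tendsto_imp_eventually_ne)
  ultimately have "\<forall>\<^sub>F j in sequentially.
      0 \<le> (\<Sum>v\<in>F. Re (levi_form f (z j) (transport a (b j) v) (transport a (b j) v)))"
    using nonneg
  proof eventually_elim
    case (elim j)
    have bj: "hermitian_inner (b j) (b j) = 1" unfolding b_def using elim(2) by (rule unit)
    note T = transport_orthonormal[OF a bj elim(1) F(3) Fa]
    have "hermitian_inner (transport a (b j) v) (gradient f (z j)) = 0" for v
    proof -
      have "gradient f (z j) = norm (gradient f (z j)) *\<^sub>R b j"
        using elim(2) by (simp add: b_def sgn_div_norm)
      then show ?thesis
        using transport_orthogonal[OF bj elim(1), of v]
          hermitian_inner_scaleR_right[of "transport a (b j) v" "norm (gradient f (z j))" "b j"]
        by simp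
    qed
    then have "0 \<le> (\<Sum>v\<in>transport a (b j) ` F. Re (levi_form f (z j) v v))"
      using T F(1,2) by (intro elim(3)[rule_format]) (auto simp: card_image)
    then show ?case using T(2) by (simp add: sum.reindex)
  qed
  note ev = this
  have "(\<lambda>j. \<Sum>v\<in>F. Re (levi_form f (z j) (transport a (b j) v) (transport a (b j) v)))
      \<longlonglongrightarrow> (\<Sum>v\<in>F. Re (levi_form f p v v))"
    by (intro tendsto_sum tendsto_Re tendsto_levi_form f z tendsto_transport b a Fa)
  from tendsto_lowerbound[OF this ev] show ?thesis by simp
qed

theorem theorem1p1:
  fixes D :: "(complex^'n) set" and Dseq :: "nat \<Rightarrow> (complex^'n) set" and q :: nat
  assumes "CARD('n) \<ge> 2" and "1 \<le> q" and "q \<le> CARD('n) - 1"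
    and "open D" and "connected D" and "D \<noteq> {}" and "bounded D" and "has_smooth_boundary D"
    and "\<And>j. j \<ge> 1 \<Longrightarrow> open (Dseq j) \<and> Dseq j \<subseteq> D"
    and "\<And>j. j \<ge> 1 \<Longrightarrow> Dseq j \<subseteq> Dseq (j + 1)"
    and "(\<Union>j\<in>{1..}. Dseq j) = D"
    and "\<And>j. j \<ge> 1 \<Longrightarrow> hyper_q_convex q (Dseq j)"
  shows "hyper_q_convex q D"
proof -
  obtain \<rho> where \<rho>: "normalized_defining_function D \<rho>"
    using normalized_defining_function_exists assms(7,8) by blast
  have smooth: "smooth \<rho>" and D: "D = {z. \<rho> z < 0}"
    using \<rho> unfolding normalized_defining_function_def defining_function_def by auto
  \<comment> \<open>Reindexed from 0, as the given sequence starts at 1.\<close>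
  define A where "A j = Dseq (Suc j)" for j
  have "(\<Union>j. A j) = (\<Union>j\<in>range Suc. Dseq j)" by (simp add: A_def)
  also have "range Suc = {1..}" by (auto simp: image_iff Suc_le_eq gr0_conv_Suc)
  finally have A_union: "(\<Union>j. A j) = D" unfolding assms(11) .
  have A: "open (A j)" "A j \<subseteq> A (Suc j)" "hyper_q_convex q (A j)" for j
    using assms(9,10,12)[of "Suc j"] by (auto simp: A_def)
  have trace: "0 \<le> (\<Sum>v\<in>F. Re (levi_form \<rho> p v v))"
    if p: "p \<in> frontier D" and F: "finite F" "card F = q" "F \<subseteq> complex_tangent_space \<rho> p" "orthonormal F"
    for p F
  proof (rule field_le_epsilon)
    fix \<epsilon> :: real assume \<epsilon>: "\<epsilon> > 0"
    \<comment> \<open>Each of the \<open>q\<close> unit vectors gains \<open>e\<close> from the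
      penalty, so the whole trace gains \<open>\<epsilon>\<close>.\<close>
    define e where "e = \<epsilon> / real q"
    have e: "e > 0" "real q * e = \<epsilon>" using \<epsilon> assms(2) by (simp_all add: e_def)
    let ?g = "penalized \<rho> e p"
    have g: "smooth ?g" using smooth by (rule smooth_penalized)
    have \<rho>p: "\<rho> p = 0" using frontier_sublevel[OF smooth] p D by blast
    then have "p \<notin> (\<Union>j. A j)" unfolding A_union D by simp
    from penalized_minimizers_converge[OF smooth \<rho>p this e(1) A(1,2) A_union[unfolded D]]
    obtain z where z: "\<And>j. z j \<in> cball p 1 - A j"
      "\<And>j x. x \<in> cball p 1 - A j \<Longrightarrow> ?g (z j) \<le> ?g x" "z \<longlonglongrightarrow> p" by blast
    have nz: "gradient ?g p \<noteq> 0"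
      unfolding penalized_gradient[OF smooth] using \<rho> p by (rule defining_function_gradient)
    have "(\<lambda>j. gradient ?g (z j)) \<longlonglongrightarrow> gradient ?g p"
      using continuous_on_tendsto_compose[OF continuous_gradient[OF g] z(3)] by simp
    then have "\<forall>\<^sub>F j in sequentially. gradient ?g (z j) \<noteq> 0"
      using nz by (rule tendsto_imp_eventually_ne)
    \<comment> \<open>Once off the bounding sphere, \<open>z j\<close> is a minimizer relative to
      the open ball, as the touching argument requires.\<close>
    moreover have "\<forall>\<^sub>F j in sequentially. dist (z j) p < 1"
      using tendstoD[OF z(3)] by simp
    ultimately have "\<forall>\<^sub>F j in sequentially. \<forall>G. finite G \<and> card G = q \<and> orthonormal G \<and>
        (\<forall>v\<in>G. hermitian_inner v (gradient ?g (z j)) = 0) \<longrightarrow> 0 \<le> (\<Sum>v\<in>G. Re (levi_form ?g (z j) v v))"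
    proof eventually_elim
      case (elim j)
      have "z j \<in> ball p 1" "z j \<notin> A j" using elim z(1)[of j] by (auto simp: dist_commute)
      note touching_trace_nonneg[OF A(3)[of j] g open_ball this _ elim(1)]
      moreover have "?g (z j) \<le> ?g x" if "x \<in> ball p 1" "x \<notin> A j" for x
        using z(2)[of x j] that by simp
      ultimately show ?case by blast
    qed
    from tendsto_trace_nonneg[OF g z(3) nz F(1,2,4) _ this]
    have "0 \<le> (\<Sum>v\<in>F. Re (levi_form ?g p v v))"
      using F(3) unfolding complex_tangent_space_gradient[OF smooth] penalized_gradient[OF smooth] by blast
    also have "\<dots> = (\<Sum>v\<in>F. Re (levi_form \<rho> p v v) + e)"
    proof (rule sum.cong[OF refl])
      fix v assume "v \<in> F"
      then have "(norm v)\<^sup>2 = 1"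
        using F(4) by (simp add: orthonormal_def Re_hermitian_inner[symmetric] power2_norm_eq_inner)
      then show "Re (levi_form ?g p v v) = Re (levi_form \<rho> p v v) + e"
        by (simp add: penalized_levi_form[OF smooth])
    qed
    also have "\<dots> = (\<Sum>v\<in>F. Re (levi_form \<rho> p v v)) + \<epsilon>"
      using e(2) F(2) by (simp add: sum.distrib)
    finally show "0 \<le> (\<Sum>v\<in>F. Re (levi_form \<rho> p v v)) + \<epsilon>" .
  qed
  have "\<forall>M :: real multiset. size M = q \<and>
      (\<forall>\<mu>. count M \<mu> \<le> vec.dim (levi_eigenspace \<rho> p \<mu>)) \<longrightarrow> 0 \<le> sum_mset M"
    if p: "p \<in> frontier D" for p
    unfolding levi_trace_iff[OF smooth] using trace[OF p] by blast
  with \<rho> show ?thesis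
    unfolding hyper_q_convex_def by (intro conjI exI[of _ \<rho>] ballI assms)
qed

end
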